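(* Let $m,n,l\ge 1$ be integers, let $\beta>0$ be real, and let $s\in\{-1,1\}$. Let $\mathcal{X}=\{\mathbf{x}^{(1)},\mathbf{x}^{(2)},\dots,\mathbf{x}^{(l)}\}$, where $\mathbf{x}^{(i)}\in\mathbb{R}^n$ for $1\le i\le l$ (no norm restriction). Let $G$ be an $m\times n$ matrix of i.i.d. standard normals, $\mathbf{u}^{(2)}$ an $m\times 1$ vector of i.i.d. standard normals, $\mathbf{h}$ an $n\times 1$ vector of i.i.d. standard normals, and $u^{(4)}$ a standard normal random variable, with $G$, $\mathbf{u}^{(2)}$, $\mathbf{h}$, $u^{(4)}$ independent of each other. Then the function $$\psi_M(\mathcal{X},\beta,s,t)=\mathbb{E}_{G,u^{(4)},\mathbf{u}^{(2)},\mathbf{h}}\,\frac{1}{\beta\sqrt{n}}\log\left(\sum_{i=1}^{l}e^{\beta\left(s\left\|\sqrt{t}\,G\mathbf{x}^{(i)}+\sqrt{1-t}\,\|\mathbf{x}^{(i)}\|_2\,\mathbf{u}^{(2)}\right\|_2+\sqrt{t}\,\|\mathbf{x}^{(i)}\|_2u^{(4)}+\sqrt{1-t}\,\mathbf{h}^T\mathbf{x}^{(i)}\right)}\right),\qquad t\in[0,1],$$ is decreasing in $t$.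
   Context: $\|\cdot\|_2$ is the Euclidean norm and $\mathbb{E}$ denotes expectation over the indicated random variables. "Decreasing" is meant in the non-strict sense: $\psi_M(\mathcal{X},\beta,s,t_1)\ge\psi_M(\mathcal{X},\beta,s,t_2)$ whenever $0\le t_1\le t_2\le 1$. *)

theory Defs
  imports "HOL-Probability.Probability"
begin

text \<open>
  Indices of the scalar entries of the four Gaussian objects: a matrix with rows \<open>'m\<close> and
  columns \<open>'n\<close>, a vector over \<open>'m\<close>, a vector over \<open>'n\<close> and a scalar.
\<close>

datatype ('m, 'n) entry_index = Ent_G 'm 'n | Ent_u2 'm | Ent_h 'n | Ent_u4

primrec gaussian_entry ::
  "('w \<Rightarrow> real^'n^'m) \<Rightarrow> ('w \<Rightarrow> real^'m) \<Rightarrow> ('w \<Rightarrow> real^'n) \<Rightarrow> ('w \<Rightarrow> real)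
    \<Rightarrow> ('m, 'n) entry_index \<Rightarrow> 'w \<Rightarrow> real" where
  "gaussian_entry G u2 h u4 (Ent_G i j) = (\<lambda>\<omega>. G \<omega> $ i $ j)"
| "gaussian_entry G u2 h u4 (Ent_u2 i) = (\<lambda>\<omega>. u2 \<omega> $ i)"
| "gaussian_entry G u2 h u4 (Ent_h j) = (\<lambda>\<omega>. h \<omega> $ j)"
| "gaussian_entry G u2 h u4 Ent_u4 = u4"

text \<open>
  Each of \<open>G\<close>, \<open>u2\<close>, \<open>h\<close> has i.i.d. standard normal entries, \<open>u4\<close> is standard normal, and the
  four objects are independent of each other. Equivalently, all scalar entries taken together are
  mutually independent and standard normal; this avoids independence of random variables with
  values in different types.
\<close>

definition indep_std_gaussians ::
  "'w measure \<Rightarrow> ('w \<Rightarrow> real^'n^'m) \<Rightarrow> ('w \<Rightarrow> real^'m) \<Rightarrow> ('w \<Rightarrow> real^'n) \<Rightarrow> ('w \<Rightarrow> real)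
    \<Rightarrow> bool" where
  "indep_std_gaussians M G u2 h u4 \<longleftrightarrow>
     prob_space.indep_vars M (\<lambda>_. borel) (gaussian_entry G u2 h u4) UNIV \<and>
     (\<forall>k. distributed M lborel (gaussian_entry G u2 h u4 k) std_normal_density)"

text \<open>
  The family \<open>x\<close> is indexed by \<open>{1..l}\<close> and may contain repetitions; the sum runs over indices.
\<close>

definition psi_M ::
  "'w measure \<Rightarrow> ('w \<Rightarrow> real^'n^'m) \<Rightarrow> ('w \<Rightarrow> real^'m) \<Rightarrow> ('w \<Rightarrow> real^'n) \<Rightarrow> ('w \<Rightarrow> real)
    \<Rightarrow> nat \<Rightarrow> (nat \<Rightarrow> real^'n) \<Rightarrow> real \<Rightarrow> real \<Rightarrow> real \<Rightarrow> real" where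
  "psi_M M G u2 h u4 l x \<beta> s t =
     (\<integral>\<omega>. 1 / (\<beta> * sqrt (real CARD('n))) *
        ln (\<Sum>i=1..l. exp (\<beta> *
          (s * norm (sqrt t *\<^sub>R (G \<omega> *v x i) + (sqrt (1 - t) * norm (x i)) *\<^sub>R u2 \<omega>)
           + sqrt t * norm (x i) * u4 \<omega>
           + sqrt (1 - t) * (h \<omega> \<bullet> x i)))) \<partial>M)"

end

theory Submission imports Defs begin

text \<open>
  At time \<open>t\<close> the exponent of the \<open>i\<close>-th summand is \<open>\<beta> (s |w\<^sub>i| + v\<^sub>i)\<close>, where the pairs \<open>(w\<^sub>i, v\<^sub>i)\<close>
  are jointly centred Gaussian, \<open>\<surd>t A\<^sub>i + \<surd>(1 - t) B\<^sub>i\<close> with \<open>A\<^sub>i = (G x\<^sub>i, |x\<^sub>i| u4)\<close> independent of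
  \<open>B\<^sub>i = (|x\<^sub>i| u2, h \<bullet> x\<^sub>i)\<close>. The coordinates of \<open>w\<^sub>i\<close> and \<open>w\<^sub>j\<close> have covariance \<open>x\<^sub>i \<bullet> x\<^sub>j\<close> in \<open>A\<close> and
  \<open>|x\<^sub>i| |x\<^sub>j|\<close> in \<open>B\<close>, while \<open>v\<^sub>i\<close> and \<open>v\<^sub>j\<close> have these two covariances in the opposite order. Increasing
  \<open>t\<close> thus moves the gap \<open>D\<^sub>i\<^sub>j = |x\<^sub>i| |x\<^sub>j| - x\<^sub>i \<bullet> x\<^sub>j \<ge> 0\<close> from the vectors to the scalars. The gap
  vanishes for \<open>i = j\<close>. With \<open>n\<^sub>i = w\<^sub>i / |w\<^sub>i|\<close> and the Gibbs weights \<open>p\<^sub>i\<close> of the exponents, the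
  mixed second derivatives of the log-sum-exp for \<open>i \<noteq> j\<close> are \<open>- \<beta>\<^sup>2 p\<^sub>i p\<^sub>j\<close> in the scalars and
  \<open>- \<beta>\<^sup>2 p\<^sub>i p\<^sub>j (n\<^sub>i \<bullet> n\<^sub>j)\<close> in the vectors, traced over their coordinates; the sign \<open>s\<close> enters squared
  and drops out. The derivative in \<open>t\<close> of the expected log-sum-exp is therefore formally
  \<open>- \<beta>\<^sup>2 / 2\<close> times the expectation of \<open>\<Sum>\<^sub>i\<^sub>j p\<^sub>i p\<^sub>j D\<^sub>i\<^sub>j (1 - n\<^sub>i \<bullet> n\<^sub>j)\<close>, which is nonpositive by the
  Cauchy-Schwarz inequality, used once for \<open>D\<^sub>i\<^sub>j\<close> and once for \<open>n\<^sub>i \<bullet> n\<^sub>j\<close>.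

  The proof replaces the formal derivative by a finite increment, in the manner of Lindeberg. By
  rotation invariance (\<open>gauss_split\<close>), the fields at times \<open>t + h\<close> and \<open>t\<close> have the laws of \<open>Y + \<surd>h A'\<close> and
  \<open>Y + \<surd>h B'\<close>, with \<open>A'\<close> and \<open>B'\<close> independent of a common \<open>Y\<close>. For every fixed value of \<open>Y\<close>, a third
  order Taylor expansion (\<open>free_energy_taylor\<close>) reduces the comparison of the two expectations to that
  of the quadratic terms, where the computation above applies, up to an error \<open>O(h\<^sup>3\<^sup>/\<^sup>2)\<close> uniform in \<open>Y\<close>
  (\<open>gauss_increment_comparison\<close>). Adding up the \<open>1 / h\<close> increments leaves an error \<open>O(\<surd>h)\<close>, which
  tends to \<open>0\<close>.

  The Euclidean norm is not smooth at the origin. It is replaced by \<open>\<surd>(|w|\<^sup>2 + \<epsilon>\<^sup>2)\<close>, whose gradient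
  still has length at most \<open>1\<close>, so that the sign argument survives; this changes the expected
  log-sum-exp by at most \<open>\<beta> \<epsilon>\<close>, and \<open>\<epsilon>\<close> tends to \<open>0\<close> at the end (\<open>interpolation_antimono\<close>).
\<close>

section \<open>Log-sum-exp and Gibbs averages\<close>

definition log_sum_exp :: "'i set \<Rightarrow> ('i \<Rightarrow> real) \<Rightarrow> real" where
  "log_sum_exp I q = ln (\<Sum>i\<in>I. exp (q i))"

definition gibbs :: "'i set \<Rightarrow> ('i \<Rightarrow> real) \<Rightarrow> 'i \<Rightarrow> real" where
  "gibbs I q i = exp (q i) / (\<Sum>j\<in>I. exp (q j))"

lemma sum_exp_pos:
  fixes q :: "'i \<Rightarrow> real"
  assumes "finite I" "I \<noteq> {}"
  shows "(\<Sum>i\<in>I. exp (q i)) > 0"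
  using assms by (intro sum_pos) auto

lemma gibbs_nonneg: "gibbs I q i \<ge> 0"
  unfolding gibbs_def by (intro divide_nonneg_nonneg sum_nonneg) auto

lemma sum_gibbs:
  assumes "finite I" "I \<noteq> {}"
  shows "(\<Sum>i\<in>I. gibbs I q i) = 1"
  unfolding gibbs_def sum_divide_distrib[symmetric] using sum_exp_pos[OF assms, of q] by simp

lemma abs_gibbs_average_le:
  fixes f :: "'i \<Rightarrow> real"
  assumes "finite I" "I \<noteq> {}" "\<And>i. i \<in> I \<Longrightarrow> \<bar>f i\<bar> \<le> c"
  shows "\<bar>\<Sum>i\<in>I. gibbs I q i * f i\<bar> \<le> c"
proof -
  have "\<bar>\<Sum>i\<in>I. gibbs I q i * f i\<bar> \<le> (\<Sum>i\<in>I. gibbs I q i * c)"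
    by (rule order_trans[OF sum_abs])
       (auto intro!: sum_mono mult_left_mono simp: abs_mult gibbs_nonneg assms)
  also have "\<dots> = c"
    using sum_gibbs[OF assms(1,2), of q] by (simp flip: sum_distrib_right)
  finally show ?thesis .
qed

text \<open>
  Log-sum-exp is monotone and commutes with adding a constant to all exponents; hence it is
  \<open>1\<close>-Lipschitz for the supremum norm.
\<close>
lemma log_sum_exp_mono_shift:
  assumes "finite I" "I \<noteq> {}" "\<And>i. i \<in> I \<Longrightarrow> p i \<le> q i + d"
  shows "log_sum_exp I p \<le> log_sum_exp I q + d"
proof -
  have "(\<Sum>i\<in>I. exp (p i)) \<le> (\<Sum>i\<in>I. exp (q i)) * exp d"
    unfolding sum_distrib_right exp_add[symmetric] by (intro sum_mono) (simp add: assms)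
  hence "log_sum_exp I p \<le> ln ((\<Sum>i\<in>I. exp (q i)) * exp d)"
    unfolding log_sum_exp_def
    using sum_exp_pos[OF assms(1,2), of p] by (subst ln_le_cancel_iff) auto
  also have "\<dots> = log_sum_exp I q + d"
    unfolding log_sum_exp_def using sum_exp_pos[OF assms(1,2), of q] by (subst ln_mult) auto
  finally show ?thesis .
qed

lemma log_sum_exp_has_derivative:
  fixes q q1 :: "'i \<Rightarrow> real \<Rightarrow> real"
  assumes "finite I" "I \<noteq> {}"
  and "\<And>i. i \<in> I \<Longrightarrow> (q i has_real_derivative q1 i r) (at r)"
  shows "((\<lambda>r. log_sum_exp I (\<lambda>i. q i r)) has_real_derivative
            (\<Sum>i\<in>I. gibbs I (\<lambda>i. q i r) i * q1 i r)) (at r)"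
  unfolding log_sum_exp_def gibbs_def
  using sum_exp_pos[OF assms(1,2), of "\<lambda>i. q i r"]
  by (auto intro!: derivative_eq_intros assms simp: sum_divide_distrib)

text \<open>
  Differentiating a Gibbs average produces, besides the average of the derivative, the covariance
  of the observable with the derivative of the exponent.
\<close>
lemma gibbs_average_has_derivative:
  fixes q q1 f f1 :: "'i \<Rightarrow> real \<Rightarrow> real"
  assumes "finite I" "I \<noteq> {}"
  and q: "\<And>i. i \<in> I \<Longrightarrow> (q i has_real_derivative q1 i r) (at r)"
  and f: "\<And>i. i \<in> I \<Longrightarrow> (f i has_real_derivative f1 i r) (at r)"
  shows "((\<lambda>r. \<Sum>i\<in>I. gibbs I (\<lambda>i. q i r) i * f i r) has_real_derivative
            (\<Sum>i\<in>I. gibbs I (\<lambda>i. q i r) i * (f1 i r + f i r * q1 i r))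
            - (\<Sum>i\<in>I. gibbs I (\<lambda>i. q i r) i * f i r) * (\<Sum>i\<in>I. gibbs I (\<lambda>i. q i r) i * q1 i r))
          (at r)"
proof -
  let ?Z = "\<lambda>r. \<Sum>i\<in>I. exp (q i r)"
  let ?N = "\<lambda>r. \<Sum>i\<in>I. exp (q i r) * f i r"
  have Z: "?Z r > 0" by (rule sum_exp_pos[OF assms(1,2)])
  have eq: "(\<Sum>i\<in>I. gibbs I (\<lambda>i. q i r) i * g i) = (\<Sum>i\<in>I. exp (q i r) * g i) / ?Z r"
    for r and g :: "'i \<Rightarrow> real"
    unfolding gibbs_def by (simp add: sum_divide_distrib)
  have dN: "(?N has_real_derivative (\<Sum>i\<in>I. exp (q i r) * (f1 i r + f i r * q1 i r))) (at r)"
    by (auto intro!: derivative_eq_intros q f simp: algebra_simps)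
  have dZ: "(?Z has_real_derivative (\<Sum>i\<in>I. exp (q i r) * q1 i r)) (at r)"
    by (auto intro!: derivative_eq_intros q)
  show ?thesis
    unfolding eq
    by (rule DERIV_cong[OF DERIV_divide[OF dN dZ]]) (use Z in \<open>auto simp: divide_simps\<close>)
qed

text \<open>
  The first derivative along the curve \<open>r \<mapsto> q i r\<close> is the Gibbs average of \<open>q1\<close>, and the second one is
  the average of \<open>q2\<close> plus the variance of \<open>q1\<close>. The third derivative is a polynomial in Gibbs averages,
  each bounded by the bounds on the observables whatever the weights are. This makes the remainder
  independent of the base point \<open>q i 0\<close>.
\<close>
lemma log_sum_exp_taylor:
  fixes I :: "'i set" and q q1 q2 q3 :: "'i \<Rightarrow> real \<Rightarrow> real" and h K1 K2 K3 :: real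
  defines "av \<equiv> (\<lambda>f r. \<Sum>i\<in>I. gibbs I (\<lambda>i. q i r) i * f i r)"
  assumes I: "finite I" "I \<noteq> {}"
  and d: "\<And>i r. i \<in> I \<Longrightarrow> (q i has_real_derivative q1 i r) (at r)"
         "\<And>i r. i \<in> I \<Longrightarrow> (q1 i has_real_derivative q2 i r) (at r)"
         "\<And>i r. i \<in> I \<Longrightarrow> (q2 i has_real_derivative q3 i r) (at r)"
  and b: "\<And>i r. i \<in> I \<Longrightarrow> \<bar>q1 i r\<bar> \<le> K1" "\<And>i r. i \<in> I \<Longrightarrow> \<bar>q2 i r\<bar> \<le> K2"
         "\<And>i r. i \<in> I \<Longrightarrow> \<bar>q3 i r\<bar> \<le> K3"
  and "h \<ge> 0"
  shows "\<bar>log_sum_exp I (\<lambda>i. q i h) - log_sum_exp I (\<lambda>i. q i 0) - h * av q1 0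
            - h\<^sup>2 / 2 * (av (\<lambda>i r. q2 i r + (q1 i r)\<^sup>2) 0 - (av q1 0)\<^sup>2)\<bar>
         \<le> (K3 + 6 * K1 * K2 + 6 * K1 ^ 3) * h ^ 3"
proof (cases "h = 0")
  case False
  hence h: "h > 0" using \<open>h \<ge> 0\<close> by simp
  define F where "F = (\<lambda>r. log_sum_exp I (\<lambda>i. q i r))"
  define V where "V = (\<lambda>r. av (\<lambda>i r. q2 i r + (q1 i r)\<^sup>2) r - (av q1 r)\<^sup>2)"
  \<comment> \<open>The third derivative, from differentiating the two averages in V.\<close>
  define T where "T = (\<lambda>r. av (\<lambda>i r. q3 i r + 3 * q1 i r * q2 i r + q1 i r ^ 3) r
     - av (\<lambda>i r. q2 i r + (q1 i r)\<^sup>2) r * av q1 r - 2 * av q1 r * V r)"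
  have dF: "(F has_real_derivative av q1 r) (at r)" for r
    unfolding F_def av_def by (intro log_sum_exp_has_derivative I d)
  have d1: "(av q1 has_real_derivative V r) (at r)" for r
    unfolding av_def V_def
    by (rule DERIV_cong[OF gibbs_average_has_derivative[OF I d(1,2)]])
       (auto simp: power2_eq_square)
  have d2': "((\<lambda>r. q2 i r + (q1 i r)\<^sup>2) has_real_derivative q3 i r + 2 * q1 i r * q2 i r) (at r)"
    if "i \<in> I" for i r
    by (auto intro!: derivative_eq_intros d that)
  have d2: "(V has_real_derivative T r) (at r)" for r
  proof -
    have "(av (\<lambda>i r. q2 i r + (q1 i r)\<^sup>2) has_real_derivative
            av (\<lambda>i r. q3 i r + 3 * q1 i r * q2 i r + q1 i r ^ 3) r
             - av (\<lambda>i r. q2 i r + (q1 i r)\<^sup>2) r * av q1 r) (at r)"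
      unfolding av_def
      by (rule DERIV_cong[OF gibbs_average_has_derivative[where f = "\<lambda>i r. q2 i r + (q1 i r)\<^sup>2"
             and ?f1.0 = "\<lambda>i r. q3 i r + 2 * q1 i r * q2 i r", OF I d(1) d2']])
         (auto intro!: sum.cong simp: algebra_simps power2_eq_square power3_eq_cube)
    thus ?thesis
      unfolding V_def T_def by (auto intro!: derivative_eq_intros d1 simp: V_def)
  qed
  obtain i0 where "i0 \<in> I" using I by auto
  hence K: "K1 \<ge> 0" "K2 \<ge> 0" "K3 \<ge> 0" using b[of i0 0] by linarith+
  have avb: "\<bar>av f r\<bar> \<le> c" if "\<And>i. i \<in> I \<Longrightarrow> \<bar>f i r\<bar> \<le> c" for f r c
    unfolding av_def by (rule abs_gibbs_average_le[OF I that])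
  have T: "\<bar>T r\<bar> \<le> 6 * (K3 + 6 * K1 * K2 + 6 * K1 ^ 3)" for r
  proof -
    have s: "(q1 i r)\<^sup>2 \<le> K1\<^sup>2" if "i \<in> I" for i
      using b(1)[OF that, of r] K by (metis abs_ge_zero power2_abs power_mono)
    have c: "\<bar>q1 i r ^ 3\<bar> \<le> K1 ^ 3" if "i \<in> I" for i
      using b(1)[OF that, of r] K by (metis abs_ge_zero power_abs power_mono)
    have m: "\<bar>q1 i r * q2 i r\<bar> \<le> K1 * K2" if "i \<in> I" for i
      unfolding abs_mult using b[OF that, of r] K by (intro mult_mono) auto
    have 1: "\<bar>av q1 r\<bar> \<le> K1" by (intro avb b)
    have 2: "\<bar>av (\<lambda>i r. q2 i r + (q1 i r)\<^sup>2) r\<bar> \<le> K2 + K1\<^sup>2"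
    proof (rule avb)
      fix i assume "i \<in> I"
      from s[OF this] b(2)[OF this, of r] show "\<bar>q2 i r + (q1 i r)\<^sup>2\<bar> \<le> K2 + K1\<^sup>2"
        using zero_le_power2[of "q1 i r"] by linarith
    qed
    have 3: "\<bar>av (\<lambda>i r. q3 i r + 3 * q1 i r * q2 i r + q1 i r ^ 3) r\<bar> \<le> K3 + 3 * (K1 * K2) + K1 ^ 3"
    proof (rule avb)
      fix i assume "i \<in> I"
      from m[OF this] c[OF this] b(3)[OF this, of r]
      show "\<bar>q3 i r + 3 * q1 i r * q2 i r + q1 i r ^ 3\<bar> \<le> K3 + 3 * (K1 * K2) + K1 ^ 3"
        by linarith
    qed
    have "(av q1 r)\<^sup>2 \<le> K1\<^sup>2"
      using 1 by (metis abs_ge_zero power2_abs power_mono)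
    hence 4: "\<bar>V r\<bar> \<le> K2 + 2 * K1\<^sup>2"
      unfolding V_def using 2 zero_le_power2[of "av q1 r"] by linarith
    have 5: "\<bar>av (\<lambda>i r. q2 i r + (q1 i r)\<^sup>2) r * av q1 r\<bar> \<le> (K2 + K1\<^sup>2) * K1"
      unfolding abs_mult using 1 2 K by (intro mult_mono) auto
    have 6: "\<bar>2 * av q1 r * V r\<bar> \<le> 2 * K1 * (K2 + 2 * K1\<^sup>2)"
      unfolding abs_mult using 1 4 K by (intro mult_mono) auto
    have "\<bar>T r\<bar> \<le> K3 + 3 * (K1 * K2) + K1 ^ 3 + (K2 + K1\<^sup>2) * K1 + 2 * K1 * (K2 + 2 * K1\<^sup>2)"
      unfolding T_def using 3 5 6 by linarith
    also have "\<dots> = K3 + 6 * K1 * K2 + 6 * K1 ^ 3"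
      by (simp add: algebra_simps power2_eq_square power3_eq_cube)
    also have "\<dots> \<le> 6 * (K3 + 6 * K1 * K2 + 6 * K1 ^ 3)"
      using K by auto
    finally show ?thesis .
  qed
  define diff where "diff = (\<lambda>m::nat. if m = 0 then F else if m = 1 then av q1 else if m = 2 then V else T)"
  have "\<exists>t>0. t < h \<and> F h = (\<Sum>m<3. diff m 0 / fact m * h ^ m) + diff 3 t / fact 3 * h ^ 3"
  proof (rule Maclaurin[OF h])
    show "\<forall>m t. m < 3 \<and> 0 \<le> t \<and> t \<le> h \<longrightarrow> (diff m has_real_derivative diff (Suc m) t) (at t)"
    proof (intro allI impI)
      fix m :: nat and t assume "m < 3 \<and> 0 \<le> t \<and> t \<le> h"
      hence "m = 0 \<or> m = 1 \<or> m = 2" by auto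
      thus "(diff m has_real_derivative diff (Suc m) t) (at t)"
        by (elim disjE) (simp_all add: diff_def dF d1 d2)
    qed
  qed (auto simp: diff_def)
  then obtain t where "F h = (\<Sum>m<3. diff m 0 / fact m * h ^ m) + diff 3 t / fact 3 * h ^ 3"
    by auto
  hence "F h = F 0 + av q1 0 * h + V 0 / 2 * h\<^sup>2 + T t / 6 * h ^ 3"
    by (simp add: diff_def eval_nat_numeral)
  hence "F h - F 0 - h * av q1 0 - h\<^sup>2 / 2 * V 0 = T t / 6 * h ^ 3"
    by (simp add: algebra_simps)
  moreover have "\<bar>T t / 6 * h ^ 3\<bar> \<le> (K3 + 6 * K1 * K2 + 6 * K1 ^ 3) * h ^ 3"
    unfolding abs_mult using T[of t] h by (intro mult_mono) auto
  ultimately show ?thesis unfolding F_def V_def by simp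
qed auto

section \<open>The smoothed Euclidean norm\<close>

text \<open>
  Both quotients are differentiated with \<open>N' = g1\<close>, which expresses each derivative through the previous
  ones and yields the bounds in turn: Cauchy-Schwarz gives \<open>|g1| \<le> |a|\<close>, hence \<open>0 \<le> g2 \<le> |a|\<^sup>2 / N\<close>,
  and \<open>N \<ge> \<epsilon>\<close> bounds the remaining denominators.
\<close>
lemma smoothed_norm_derivatives:
  fixes w a :: "'a::real_inner" and \<epsilon> :: real
  assumes "\<epsilon> > 0"
  defines "N \<equiv> (\<lambda>r. sqrt ((norm (w + r *\<^sub>R a))\<^sup>2 + \<epsilon>\<^sup>2))"
  defines "D \<equiv> (\<lambda>r. (w + r *\<^sub>R a) \<bullet> a)"
  defines "g1 \<equiv> (\<lambda>r. D r / N r)"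
  defines "g2 \<equiv> (\<lambda>r. ((norm a)\<^sup>2 - (g1 r)\<^sup>2) / N r)"
  defines "g3 \<equiv> (\<lambda>r. - 3 * g1 r * g2 r / N r)"
  shows "(N has_real_derivative g1 r) (at r)" "(g1 has_real_derivative g2 r) (at r)"
    "(g2 has_real_derivative g3 r) (at r)"
    "\<bar>g1 r\<bar> \<le> norm a" "\<bar>g2 r\<bar> \<le> (norm a)\<^sup>2 / \<epsilon>" "\<bar>g3 r\<bar> \<le> 3 * norm a ^ 3 / \<epsilon>\<^sup>2"
proof -
  have N\<epsilon>: "N r \<ge> \<epsilon>" for r
    unfolding N_def using assms(1) by (intro real_le_rsqrt) auto
  have N: "N r > 0" for r
    using N\<epsilon>[of r] assms(1) by linarith
  have Nn: "norm (w + r *\<^sub>R a) \<le> N r" for r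
    unfolding N_def by (intro real_le_rsqrt) auto
  have sq: "(norm (w + r *\<^sub>R a))\<^sup>2 = (w + r *\<^sub>R a) \<bullet> (w + r *\<^sub>R a)" for r
    by (simp add: power2_norm_eq_inner)
  have pos: "(w + r *\<^sub>R a) \<bullet> (w + r *\<^sub>R a) + \<epsilon>\<^sup>2 > 0" for r
    using assms(1) by (intro add_nonneg_pos) auto
  have N': "N = (\<lambda>r. sqrt (w \<bullet> w + 2 * r * (w \<bullet> a) + r\<^sup>2 * (a \<bullet> a) + \<epsilon>\<^sup>2))"
    unfolding N_def sq by (auto simp: inner_simps inner_commute algebra_simps power2_eq_square)
  have pos': "w \<bullet> w + 2 * r * (w \<bullet> a) + r\<^sup>2 * (a \<bullet> a) + \<epsilon>\<^sup>2 > 0" for r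
    using pos[of r] by (auto simp: inner_simps inner_commute algebra_simps power2_eq_square)
  have D': "D = (\<lambda>r. w \<bullet> a + r * (a \<bullet> a))"
    unfolding D_def by (auto simp: inner_simps)
  show dN: "(N has_real_derivative g1 r) (at r)" for r
    unfolding g1_def unfolding N' D' using pos'[of r]
    by (auto intro!: derivative_eq_intros simp: field_simps)
  have dD: "(D has_real_derivative (norm a)\<^sup>2) (at r)" for r
    unfolding D' by (auto intro!: derivative_eq_intros simp: power2_norm_eq_inner)
  show d1: "(g1 has_real_derivative g2 r) (at r)" for r
  proof -
    have "((\<lambda>r. D r / N r) has_real_derivative ((norm a)\<^sup>2 * N r - D r * g1 r) / (N r * N r)) (at r)"
      using N[of r] by (intro DERIV_divide dD dN) auto
    also have "((norm a)\<^sup>2 * N r - D r * g1 r) / (N r * N r) = g2 r"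
      unfolding g2_def g1_def using N[of r] by (simp add: field_simps power2_eq_square)
    finally show ?thesis unfolding g1_def .
  qed
  show "(g2 has_real_derivative g3 r) (at r)"
  proof -
    have "((\<lambda>r. ((norm a)\<^sup>2 - (g1 r)\<^sup>2) / N r) has_real_derivative
        ((- (2 * g1 r * g2 r)) * N r - ((norm a)\<^sup>2 - (g1 r)\<^sup>2) * g1 r) / (N r * N r)) (at r)"
      using N[of r] by (intro DERIV_divide dN) (auto intro!: derivative_eq_intros d1)
    also have "((- (2 * g1 r * g2 r)) * N r - ((norm a)\<^sup>2 - (g1 r)\<^sup>2) * g1 r) / (N r * N r) = g3 r"
      unfolding g3_def g2_def using N[of r] by (simp add: field_simps)
    finally show ?thesis unfolding g2_def .
  qed
  show g1: "\<bar>g1 r\<bar> \<le> norm a"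
  proof -
    have "\<bar>D r\<bar> \<le> N r * norm a"
      unfolding D_def
      by (rule order_trans[OF Cauchy_Schwarz_ineq2]) (intro mult_right_mono Nn norm_ge_zero)
    thus ?thesis unfolding g1_def using N[of r] by (simp add: field_simps)
  qed
  have g1s: "(g1 r)\<^sup>2 \<le> (norm a)\<^sup>2"
    using g1 by (metis abs_ge_zero power2_abs power_mono)
  have g2N: "\<bar>g2 r\<bar> \<le> (norm a)\<^sup>2 / N r"
    unfolding g2_def using g1s N[of r] by (simp add: divide_right_mono)
  also have "\<dots> \<le> (norm a)\<^sup>2 / \<epsilon>"
    using N\<epsilon>[of r] assms(1) by (intro divide_left_mono) auto
  finally show g2: "\<bar>g2 r\<bar> \<le> (norm a)\<^sup>2 / \<epsilon>" .
  have "\<bar>g3 r\<bar> = 3 * \<bar>g1 r\<bar> * \<bar>g2 r\<bar> / N r"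
    unfolding g3_def using N[of r] by (simp add: abs_mult)
  also have "\<dots> \<le> 3 * norm a * ((norm a)\<^sup>2 / \<epsilon>) / \<epsilon>"
    using g1 g2 N[of r] N\<epsilon>[of r] assms(1) by (intro frac_le mult_mono) auto
  also have "\<dots> = 3 * norm a ^ 3 / \<epsilon>\<^sup>2"
    by (simp add: power2_eq_square power3_eq_cube)
  finally show "\<bar>g3 r\<bar> \<le> 3 * norm a ^ 3 / \<epsilon>\<^sup>2" .
qed

section \<open>The free energy and its expansion along a line\<close>

text \<open>
  A configuration assigns to each index a pair of a vector and a scalar. The norm of the pair
  \<open>(w, \<epsilon>)\<close> is the smoothed norm \<open>\<surd>(|w|\<^sup>2 + \<epsilon>\<^sup>2)\<close>; it is \<open>1\<close>-Lipschitz jointly in \<open>w\<close> and \<open>\<epsilon>\<close>, and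
  \<open>\<epsilon> = 0\<close> gives back the Euclidean norm.
\<close>
definition free_energy ::
  "'i set \<Rightarrow> real \<Rightarrow> real \<Rightarrow> real \<Rightarrow> ('i \<Rightarrow> 'a::euclidean_space \<times> real) \<Rightarrow> real" where
  "free_energy I \<beta> s \<epsilon> y = log_sum_exp I (\<lambda>i. \<beta> * (s * norm (fst (y i), \<epsilon>) + snd (y i)))"

definition gibbs_weight ::
  "'i set \<Rightarrow> real \<Rightarrow> real \<Rightarrow> real \<Rightarrow> ('i \<Rightarrow> 'a::euclidean_space \<times> real) \<Rightarrow> 'i \<Rightarrow> real" where
  "gibbs_weight I \<beta> s \<epsilon> y = gibbs I (\<lambda>i. \<beta> * (s * norm (fst (y i), \<epsilon>) + snd (y i)))"

text \<open>
  The gradient of \<open>(w, r) \<mapsto> s |(w, \<epsilon>)| + r\<close> at \<open>v\<close>, for \<open>\<epsilon> \<noteq> 0\<close>.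
\<close>
definition slope :: "real \<Rightarrow> real \<Rightarrow> 'a::euclidean_space \<times> real \<Rightarrow> 'a \<times> real" where
  "slope s \<epsilon> v = ((s / norm (fst v, \<epsilon>)) *\<^sub>R fst v, 1)"

text \<open>
  The second derivative of the same function at \<open>v\<close> in direction \<open>e\<close>, for \<open>s\<^sup>2 = 1\<close>: the square of the
  slope is then the square of the derivative of the norm itself.
\<close>
definition curvature :: "real \<Rightarrow> real \<Rightarrow> 'a::euclidean_space \<times> real \<Rightarrow> 'a \<times> real \<Rightarrow> real" where
  "curvature s \<epsilon> v e = s * ((norm (fst e))\<^sup>2 - (fst (slope s \<epsilon> v) \<bullet> fst e)\<^sup>2) / norm (fst v, \<epsilon>)"

lemma norm_fst_slope_le:
  assumes "\<bar>s\<bar> = 1"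
  shows "norm (fst (slope s \<epsilon> v)) \<le> 1"
proof -
  have "norm (fst v) \<le> norm (fst v, \<epsilon>)"
    by (simp add: norm_Pair real_le_rsqrt)
  moreover have "norm (fst (slope s \<epsilon> v)) = norm (fst v) / norm (fst v, \<epsilon>)"
    using assms by (simp add: slope_def)
  ultimately show ?thesis by (auto intro: divide_le_eq_1[THEN iffD2] simp: divide_le_eq_1)
qed

lemma norm_component_le: "norm (fst p) \<le> norm p" "norm (snd p) \<le> norm p"
  by (metis norm_fst_le prod.collapse, metis norm_snd_le prod.collapse)

text \<open>
  One Lipschitz estimate serves two purposes: with equal configurations it controls the effect of the
  smoothing, and with equal \<open>\<epsilon>\<close> it gives the linear growth that makes the free energy of a Gaussian
  configuration integrable.
\<close>
lemma free_energy_shift: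
  assumes "finite I" "I \<noteq> {}" "\<beta> > 0" "\<bar>s\<bar> = 1"
  shows "\<bar>free_energy I \<beta> s \<epsilon> y - free_energy I \<beta> s \<epsilon>' y'\<bar>
         \<le> \<beta> * (\<bar>\<epsilon> - \<epsilon>'\<bar> + 2 * (\<Sum>i\<in>I. norm (y i - y' i)))"
proof -
  have le: "free_energy I \<beta> s \<epsilon> y \<le> free_energy I \<beta> s \<epsilon>' y'
       + \<beta> * (\<bar>\<epsilon> - \<epsilon>'\<bar> + 2 * (\<Sum>i\<in>I. norm (y i - y' i)))" for \<epsilon> \<epsilon>' y y'
    unfolding free_energy_def
  proof (rule log_sum_exp_mono_shift[OF assms(1,2)])
    fix i assume i: "i \<in> I"
    let ?d = "y i - y' i"
    have "\<bar>norm (fst (y i), \<epsilon>) - norm (fst (y' i), \<epsilon>')\<bar> \<le> norm ((fst (y i), \<epsilon>) - (fst (y' i), \<epsilon>'))"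
      by (rule norm_triangle_ineq3)
    also have "\<dots> \<le> norm (fst ?d) + norm (\<epsilon> - \<epsilon>')"
      using norm_Pair_le[of "fst ?d" "\<epsilon> - \<epsilon>'"] by simp
    finally have "\<bar>norm (fst (y i), \<epsilon>) - norm (fst (y' i), \<epsilon>')\<bar> \<le> norm (fst ?d) + \<bar>\<epsilon> - \<epsilon>'\<bar>"
      by simp
    hence 1: "\<bar>s * norm (fst (y i), \<epsilon>) - s * norm (fst (y' i), \<epsilon>')\<bar> \<le> norm (fst ?d) + \<bar>\<epsilon> - \<epsilon>'\<bar>"
      using assms(4) by (simp add: abs_mult flip: right_diff_distrib)
    have 2: "norm (fst ?d) \<le> norm ?d" by (rule norm_component_le)
    have 3: "\<bar>snd (y i) - snd (y' i)\<bar> \<le> norm ?d"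
      using norm_component_le(2)[of ?d] by simp
    have 4: "norm ?d \<le> (\<Sum>i\<in>I. norm (y i - y' i))"
      using i assms(1) by (intro member_le_sum) auto
    from 1 2 3 4 have "s * norm (fst (y i), \<epsilon>) + snd (y i)
      \<le> s * norm (fst (y' i), \<epsilon>') + snd (y' i) + (\<bar>\<epsilon> - \<epsilon>'\<bar> + 2 * (\<Sum>i\<in>I. norm (y i - y' i)))"
      by linarith
    thus "\<beta> * (s * norm (fst (y i), \<epsilon>) + snd (y i)) \<le> \<beta> * (s * norm (fst (y' i), \<epsilon>') + snd (y' i))
       + \<beta> * (\<bar>\<epsilon> - \<epsilon>'\<bar> + 2 * (\<Sum>i\<in>I. norm (y i - y' i)))"
      using assms(3) by (simp flip: distrib_left)
  qed
  show ?thesis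
    using le[of \<epsilon> y \<epsilon>' y'] le[of \<epsilon>' y' \<epsilon> y] by (simp add: norm_minus_commute abs_minus_commute)
qed

text \<open>
  The coefficient of the remainder depends on \<open>\<beta>\<close> and \<open>\<epsilon>\<close> but not on \<open>y\<close>, and the remainder is cubic in
  the direction \<open>e\<close>; a Gaussian direction therefore contributes a finite third moment.
\<close>
lemma free_energy_taylor:
  fixes I :: "'i set" and y e :: "'i \<Rightarrow> 'a::euclidean_space \<times> real" and \<beta> s \<epsilon> \<eta> :: real
  assumes "finite I" "I \<noteq> {}" "\<beta> > 0" "\<bar>s\<bar> = 1" "\<epsilon> > 0" "\<eta> \<ge> 0"
  defines "p \<equiv> gibbs_weight I \<beta> s \<epsilon> y"
  defines "n \<equiv> (\<lambda>i. slope s \<epsilon> (y i))"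
  shows "\<bar>free_energy I \<beta> s \<epsilon> (\<lambda>i. y i + \<eta> *\<^sub>R e i) - free_energy I \<beta> s \<epsilon> y
           - \<eta> * (\<Sum>i\<in>I. p i * (\<beta> * (n i \<bullet> e i)))
           - \<eta>\<^sup>2 / 2 * ((\<Sum>i\<in>I. p i * (\<beta> * curvature s \<epsilon> (y i) (e i) + (\<beta> * (n i \<bullet> e i))\<^sup>2))
                     - (\<Sum>i\<in>I. p i * (\<beta> * (n i \<bullet> e i)))\<^sup>2)\<bar>
         \<le> (3 * \<beta> / \<epsilon>\<^sup>2 + 12 * \<beta>\<^sup>2 / \<epsilon> + 48 * \<beta> ^ 3) * (\<Sum>i\<in>I. norm (e i)) ^ 3 * \<eta> ^ 3"
proof -
  define K where "K = (\<Sum>i\<in>I. norm (e i))"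
  define N where "N i r = sqrt ((norm (fst (y i) + r *\<^sub>R fst (e i)))\<^sup>2 + \<epsilon>\<^sup>2)" for i r
  define g1 where "g1 i r = (fst (y i) + r *\<^sub>R fst (e i)) \<bullet> fst (e i) / N i r" for i r
  define g2 where "g2 i r = ((norm (fst (e i)))\<^sup>2 - (g1 i r)\<^sup>2) / N i r" for i r
  define g3 where "g3 i r = - 3 * g1 i r * g2 i r / N i r" for i r
  note g = smoothed_norm_derivatives[OF \<open>\<epsilon> > 0\<close>, where w = "fst (y i)" and a = "fst (e i)" for i,
      folded N_def, folded g1_def, folded g2_def, folded g3_def]
  define q where "q = (\<lambda>i r. \<beta> * (s * N i r + (snd (y i) + r * snd (e i))))"
  define q1 where "q1 = (\<lambda>i r. \<beta> * (s * g1 i r + snd (e i)))"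
  define q2 where "q2 = (\<lambda>i r. \<beta> * (s * g2 i r))"
  define q3 where "q3 = (\<lambda>i r. \<beta> * (s * g3 i r))"
  have dq: "(q i has_real_derivative q1 i r) (at r)"
     "(q1 i has_real_derivative q2 i r) (at r)"
     "(q2 i has_real_derivative q3 i r) (at r)" for i r
    unfolding q_def q1_def q2_def q3_def by (auto intro!: derivative_eq_intros g(1-3))
  have b: "\<bar>q1 i r\<bar> \<le> \<beta> * (2 * K)" "\<bar>q2 i r\<bar> \<le> \<beta> * (K\<^sup>2 / \<epsilon>)" "\<bar>q3 i r\<bar> \<le> \<beta> * (3 * K ^ 3 / \<epsilon>\<^sup>2)"
    if i: "i \<in> I" for i r
  proof -
    have "norm (e i) \<le> K" unfolding K_def using i assms(1) by (intro member_le_sum) auto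
    hence f: "norm (fst (e i)) \<le> K" and sn: "\<bar>snd (e i)\<bar> \<le> K"
      using norm_component_le[of "e i"] by auto
    have "\<bar>g1 i r\<bar> \<le> norm (fst (e i))" by (rule g(4))
    note f' = order_trans[OF this f]
    have "\<bar>s * g1 i r + snd (e i)\<bar> \<le> \<bar>s * g1 i r\<bar> + \<bar>snd (e i)\<bar>" by (rule abs_triangle_ineq)
    also have "\<dots> \<le> 2 * K" using f' sn assms(4) by (simp add: abs_mult)
    finally show "\<bar>q1 i r\<bar> \<le> \<beta> * (2 * K)" unfolding q1_def using assms(3) by (simp add: abs_mult)
    have "\<bar>g2 i r\<bar> \<le> (norm (fst (e i)))\<^sup>2 / \<epsilon>" by (rule g(5))
    also have "\<dots> \<le> K\<^sup>2 / \<epsilon>" using f assms(5) by (intro divide_right_mono power_mono) auto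
    finally show "\<bar>q2 i r\<bar> \<le> \<beta> * (K\<^sup>2 / \<epsilon>)" unfolding q2_def abs_mult using assms(3,4) by (simp add: mult_left_mono del: times_divide_eq_right)
    have "\<bar>g3 i r\<bar> \<le> 3 * norm (fst (e i)) ^ 3 / \<epsilon>\<^sup>2" by (rule g(6))
    also have "\<dots> \<le> 3 * K ^ 3 / \<epsilon>\<^sup>2" using f assms(5) by (intro divide_right_mono mult_left_mono power_mono) auto
    finally show "\<bar>q3 i r\<bar> \<le> \<beta> * (3 * K ^ 3 / \<epsilon>\<^sup>2)" unfolding q3_def abs_mult using assms(3,4) by (simp add: mult_left_mono del: times_divide_eq_right)
  qed
  have e1: "free_energy I \<beta> s \<epsilon> (\<lambda>i. y i + r *\<^sub>R e i) = log_sum_exp I (\<lambda>i. q i r)" for r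
    by (simp add: free_energy_def q_def N_def norm_Pair)
  have e2: "gibbs I (\<lambda>i. q i 0) = p"
    by (simp add: p_def gibbs_weight_def q_def N_def norm_Pair)
  have e3: "q1 i 0 = \<beta> * (n i \<bullet> e i)" for i
    by (simp add: q1_def n_def slope_def inner_prod_def g1_def N_def norm_Pair)
  have "(fst (n i) \<bullet> fst (e i))\<^sup>2 = (g1 i 0)\<^sup>2" for i
    using assms(4) by (simp add: n_def slope_def g1_def N_def norm_Pair power_mult_distrib power_divide
                        abs_square_eq_1)
  hence e4: "q2 i 0 = \<beta> * curvature s \<epsilon> (y i) (e i)" for i
    unfolding n_def by (simp add: curvature_def q2_def g2_def N_def norm_Pair)
  have C: "(\<beta> * (3 * K ^ 3 / \<epsilon>\<^sup>2) + 6 * (\<beta> * (2 * K)) * (\<beta> * (K\<^sup>2 / \<epsilon>)) + 6 * (\<beta> * (2 * K)) ^ 3)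
     = (3 * \<beta> / \<epsilon>\<^sup>2 + 12 * \<beta>\<^sup>2 / \<epsilon> + 48 * \<beta> ^ 3) * K ^ 3"
    by (simp add: field_simps power2_eq_square power3_eq_cube)
  from log_sum_exp_taylor[where q = q and ?q1.0 = q1 and ?q2.0 = q2 and ?q3.0 = q3,
      OF assms(1,2) dq b assms(6)]
  show ?thesis
    unfolding e1[symmetric] e2 e3 e4 C unfolding K_def by simp
qed

section \<open>The standard Gaussian measure on coordinates\<close>

definition gauss :: "('k \<Rightarrow> real) measure" where
  "gauss = PiM UNIV (\<lambda>_. std_normal_distribution)"

interpretation std_normal: real_distribution std_normal_distribution
  by (rule real_dist_normal_dist)

interpretation std_normals: product_prob_space "\<lambda>_. std_normal_distribution" UNIV
  by unfold_locales

lemma sets_gauss [measurable_cong]: "sets gauss = sets (PiM UNIV (\<lambda>_. borel))"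
  unfolding gauss_def by (intro sets_PiM_cong) auto

lemma space_gauss [simp]: "space gauss = UNIV"
  unfolding gauss_def by (simp add: space_PiM)

interpretation gauss: prob_space gauss
  unfolding gauss_def by (rule std_normals.P.prob_space_axioms)

lemma gauss_prob_UNIV [simp]: "measure gauss UNIV = 1"
  using gauss.prob_space by simp

interpretation gauss2: pair_prob_space gauss gauss ..

lemma integrable_std_normal_abs_power: "integrable std_normal_distribution (\<lambda>x. \<bar>x\<bar> ^ n)"
  by (subst integrable_density) (auto intro: integrable_std_normal_moment_abs)

lemma gauss_coordinate_distr: "distr gauss borel (\<lambda>z. z k) = std_normal_distribution"
proof -
  have "distr gauss std_normal_distribution (\<lambda>z. z k) = std_normal_distribution"
    unfolding gauss_def by (rule std_normals.PiM_component) simp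
  thus ?thesis by (metis distr_cong sets_density sets_lborel)
qed

lemma integrable_gauss_coordinate_power: "integrable gauss (\<lambda>z. \<bar>z k\<bar> ^ n)"
proof -
  have "integrable (distr gauss borel (\<lambda>z. z k)) (\<lambda>x. \<bar>x\<bar> ^ n)"
    unfolding gauss_coordinate_distr by (rule integrable_std_normal_abs_power)
  thus ?thesis by (subst (asm) integrable_distr_eq) auto
qed

lemma integral_gauss_coordinate: "(\<integral>z. z k \<partial>gauss) = 0"
proof -
  have "(\<integral>z. z k \<partial>gauss) = (\<integral>x. x \<partial>distr gauss borel (\<lambda>z. z k))"
    by (subst integral_distr) auto
  also have "\<dots> = 0"
    unfolding gauss_coordinate_distr using integral_std_normal_distribution_moment_odd[of 1] by simp
  finally show ?thesis .
qed

lemma integrable_gauss_product: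
  fixes j k :: "'k::finite"
  shows "integrable gauss (\<lambda>z. z j * z k)"
proof (rule Bochner_Integration.integrable_bound)
  show "integrable gauss (\<lambda>z. \<bar>z j\<bar> ^ 2 + \<bar>z k\<bar> ^ 2)"
    by (intro Bochner_Integration.integrable_add integrable_gauss_coordinate_power)
  have "norm (x * y) \<le> norm (\<bar>x\<bar>\<^sup>2 + \<bar>y\<bar>\<^sup>2)" for x y :: real
    using sum_squares_bound[of "\<bar>x\<bar>" "\<bar>y\<bar>"] by (auto simp: abs_mult intro: order_trans[rotated])
  thus "AE z in gauss. norm (z j * z k) \<le> norm (\<bar>z j\<bar>\<^sup>2 + \<bar>z k\<bar>\<^sup>2)" by auto
qed auto

lemma integral_gauss_product:
  fixes j k :: "'k::finite"
  shows "(\<integral>z. z j * z k \<partial>gauss) = (if j = k then 1 else 0)"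
proof (cases "j = k")
  case True
  have "(\<integral>z. z k * z k \<partial>gauss) = (\<integral>x. x ^ 2 \<partial>distr gauss borel (\<lambda>z. z k))"
    by (subst integral_distr) (auto simp: power2_eq_square)
  also have "\<dots> = 1"
    unfolding gauss_coordinate_distr using std_normal_distribution_even_moments(1)[of 1] by simp
  finally show ?thesis using True by simp
next
  case False
  let ?f = "\<lambda>i x. if i = j \<or> i = k then x else (1::real)"
  have eq: "(\<Prod>i\<in>UNIV. ?f i (z i)) = z j * z k" for z :: "'k \<Rightarrow> real"
  proof -
    have "(\<Prod>i\<in>UNIV. ?f i (z i)) = (\<Prod>i\<in>{j,k}. ?f i (z i))"
      by (intro prod.mono_neutral_right) auto
    thus ?thesis using False by simp
  qed
  have m: "(\<integral>x. x \<partial>std_normal_distribution) = 0"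
    using integral_std_normal_distribution_moment_odd[of 1] by simp
  have "(\<integral>z. z j * z k \<partial>gauss) = (\<integral>z. (\<Prod>i\<in>UNIV. ?f i (z i)) \<partial>PiM UNIV (\<lambda>_. std_normal_distribution))"
    unfolding gauss_def eq ..
  also have "\<dots> = (\<Prod>i\<in>UNIV. integral\<^sup>L std_normal_distribution (?f i))"
  proof (rule std_normals.product_integral_prod)
    show "integrable std_normal_distribution (?f i)" for i
      using integrable_std_normal_distribution_moment[of 1] by (cases "i = j \<or> i = k") auto
  qed simp
  also have "\<dots> = 0"
    using m by (intro prod_zero) (auto intro!: exI[of _ j])
  finally show ?thesis using False by simp
qed

lemma gauss_linear_form:
  fixes c d :: "'k::finite \<Rightarrow> real"
  shows "(\<integral>z. (\<Sum>k\<in>UNIV. c k * z k) \<partial>gauss) = 0"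
    and "(\<integral>z. (\<Sum>k\<in>UNIV. c k * z k) * (\<Sum>k\<in>UNIV. d k * z k) \<partial>gauss) = (\<Sum>k\<in>UNIV. c k * d k)"
proof -
  have [simp]: "integrable gauss (\<lambda>z. z k)" for k :: 'k
    using integrable_gauss_coordinate_power[of k 1] integrable_abs_cancel[of gauss "\<lambda>z. z k"] by auto
  show "(\<integral>z. (\<Sum>k\<in>UNIV. c k * z k) \<partial>gauss) = 0"
    by (simp add: integral_gauss_coordinate)
  have "(\<integral>z. (\<Sum>k\<in>UNIV. c k * z k) * (\<Sum>k\<in>UNIV. d k * z k) \<partial>gauss)
      = (\<integral>z. (\<Sum>j\<in>UNIV. \<Sum>k\<in>UNIV. c j * d k * (z j * z k)) \<partial>gauss)"
    by (simp add: sum_product ac_simps)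
  also have "\<dots> = (\<Sum>j\<in>UNIV. \<Sum>k\<in>UNIV. c j * d k * (if j = k then 1 else 0))"
    by (subst Bochner_Integration.integral_sum
          | intro Bochner_Integration.integrable_sum integrable_mult_right integrable_gauss_product
          | simp add: integral_gauss_product integrable_gauss_product)+
  also have "\<dots> = (\<Sum>k\<in>UNIV. c k * d k)"
    by (intro sum.cong refl) (simp add: if_distrib[of "(*) _"] cong: if_cong)
  finally show "(\<integral>z. (\<Sum>k\<in>UNIV. c k * z k) * (\<Sum>k\<in>UNIV. d k * z k) \<partial>gauss) = (\<Sum>k\<in>UNIV. c k * d k)" .
qed

text \<open>
  Every term is at most the largest one, whose cube is a term of the right-hand side.
\<close>
lemma cube_sum_le:
  fixes r :: "'i \<Rightarrow> real"
  assumes "finite I" "\<And>i. i \<in> I \<Longrightarrow> r i \<ge> 0"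
  shows "(\<Sum>i\<in>I. r i) ^ 3 \<le> real (card I) ^ 3 * (\<Sum>i\<in>I. r i ^ 3)"
proof (cases "I = {}")
  case False
  have "Max (r ` I) \<in> r ` I"
    using assms(1) False by (intro Max_in) auto
  then obtain k where k: "k \<in> I" "Max (r ` I) = r k" by (rule imageE)
  have le: "r i \<le> r k" if "i \<in> I" for i
    using assms(1) that unfolding k(2)[symmetric] by simp
  have "(\<Sum>i\<in>I. r i) \<le> real (card I) * r k"
    using sum_bounded_above[of I r "r k"] le by simp
  hence "(\<Sum>i\<in>I. r i) ^ 3 \<le> (real (card I) * r k) ^ 3"
    by (intro power_mono sum_nonneg assms)
  also have "\<dots> \<le> real (card I) ^ 3 * (\<Sum>i\<in>I. r i ^ 3)"
    unfolding power_mult_distrib using k(1) assms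
    by (intro mult_left_mono member_le_sum) auto
  finally show ?thesis .
qed (use assms in simp)

lemma integrable_gauss_abs_sum_cubed:
  "integrable gauss (\<lambda>z. (\<Sum>k\<in>UNIV. \<bar>z (k::'k::finite)\<bar>) ^ 3)"
proof (rule Bochner_Integration.integrable_bound)
  show "integrable gauss (\<lambda>z. real CARD('k) ^ 3 * (\<Sum>k\<in>UNIV. \<bar>z (k::'k)\<bar> ^ 3))"
    by (intro integrable_mult_right Bochner_Integration.integrable_sum integrable_gauss_coordinate_power)
  show "AE z in gauss. norm ((\<Sum>k\<in>UNIV. \<bar>z (k::'k)\<bar>) ^ 3)
          \<le> norm (real CARD('k) ^ 3 * (\<Sum>k\<in>UNIV. \<bar>z k\<bar> ^ 3))"
    using cube_sum_le[of "UNIV :: 'k set"] by (auto simp: sum_nonneg)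
qed auto

section \<open>Rotation invariance of Gaussian pairs\<close>

text \<open>
  Characteristic functions also cover the degenerate cases \<open>c = 0\<close> and \<open>d = 0\<close>, in which one of the
  scaled variables has no density.
\<close>
lemma std_normal_rotation:
  fixes c d :: real
  assumes "c\<^sup>2 + d\<^sup>2 = 1"
  shows "distr (std_normal_distribution \<Otimes>\<^sub>M std_normal_distribution) borel (\<lambda>(x, y). c * x + d * y)
         = std_normal_distribution"
proof -
  let ?N = std_normal_distribution
  interpret P: pair_prob_space ?N ?N ..
  have meas [measurable]: "(\<lambda>(x, y). c * x + d * y) \<in> borel_measurable (?N \<Otimes>\<^sub>M ?N)"
    by measurable
  let ?D = "distr (?N \<Otimes>\<^sub>M ?N) borel (\<lambda>(x, y). c * x + d * y)"
  have D: "real_distribution ?D"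
    unfolding real_distribution_def real_distribution_axioms_def
    by (auto intro!: P.prob_space_distr)
  have "char ?D t = char ?N t" for t
  proof -
    have int: "integrable (?N \<Otimes>\<^sub>M ?N) (\<lambda>(x, y). iexp (t * c * x) * iexp (t * d * y))"
      by (intro P.integrable_const_bound[of _ 1]) (auto simp: norm_mult case_prod_beta')
    have "char ?D t = (\<integral>p. iexp (t * c * fst p) * iexp (t * d * snd p) \<partial>(?N \<Otimes>\<^sub>M ?N))"
      unfolding char_def
      by (subst integral_distr)
         (auto simp: exp_add[symmetric] case_prod_beta' algebra_simps)
    also have "\<dots> = (\<integral>x. (\<integral>y. iexp (t * c * x) * iexp (t * d * y) \<partial>?N) \<partial>?N)"
      by (subst P.integral_fst'[symmetric]) (use int in \<open>auto simp: case_prod_beta'\<close>)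
    also have "\<dots> = char ?N (t * c) * char ?N (t * d)"
      unfolding char_def by simp
    also have "\<dots> = exp (- ((t * c)\<^sup>2 + (t * d)\<^sup>2) / 2)"
      unfolding char_std_normal_distribution of_real_mult[symmetric] exp_add[symmetric]
      by (simp add: field_simps)
    also have "(t * c)\<^sup>2 + (t * d)\<^sup>2 = t\<^sup>2"
      using assms by (simp add: power_mult_distrib flip: distrib_left)
    finally show ?thesis by (simp add: char_std_normal_distribution)
  qed
  thus ?thesis by (intro Levy_uniqueness D real_dist_normal_dist ext)
qed

lemma measurable_gauss_rotation [measurable]:
  fixes c d :: "'k::finite \<Rightarrow> real"
  shows "(\<lambda>(z, z') k. c k * z k + d k * z' k) \<in> gauss \<Otimes>\<^sub>M gauss \<rightarrow>\<^sub>M gauss"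
proof -
  have "(\<lambda>(z, z') k. c k * z k + d k * z' k) \<in> gauss \<Otimes>\<^sub>M gauss \<rightarrow>\<^sub>M PiM UNIV (\<lambda>_. borel)"
    by (rule measurable_PiM_single') (auto simp: case_prod_beta')
  thus ?thesis by simp
qed

text \<open>
  Each coordinate may be rotated by its own angle. Both measures are compared on boxes, where Tonelli's
  theorem factorises the image measure into its one-dimensional rotations.
\<close>
lemma gauss_rotation:
  fixes c d :: "'k::finite \<Rightarrow> real"
  assumes "\<And>k. (c k)\<^sup>2 + (d k)\<^sup>2 = 1"
  shows "distr (gauss \<Otimes>\<^sub>M gauss) gauss (\<lambda>(z, z') k. c k * z k + d k * z' k) = gauss"
proof -
  let ?N = std_normal_distribution
  let ?T = "\<lambda>(z, z') k. c k * z k + d k * z' k :: real"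
  have T [measurable]: "?T \<in> gauss \<Otimes>\<^sub>M gauss \<rightarrow>\<^sub>M gauss"
    by (rule measurable_gauss_rotation)
  have "distr (gauss \<Otimes>\<^sub>M gauss) gauss ?T = PiM UNIV (\<lambda>_. ?N)"
  proof (rule std_normals.PiM_eqI)
    show "sets (distr (gauss \<Otimes>\<^sub>M gauss) gauss ?T) = sets (PiM UNIV (\<lambda>_. ?N))"
      by (simp add: gauss_def)
    fix A :: "'k \<Rightarrow> real set" assume "\<And>k. k \<in> UNIV \<Longrightarrow> A k \<in> sets ?N"
    hence [measurable]: "A k \<in> sets borel" for k by simp
    have box [measurable]: "Pi\<^sub>E UNIV A \<in> sets gauss"
      unfolding gauss_def by (intro sets_PiM_I_finite) auto
    define S where "S k x = {y. c k * x + d k * y \<in> A k}" for k x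
    have [measurable]: "S k x \<in> sets borel" for k x
      unfolding S_def by measurable
    have "emeasure (distr (gauss \<Otimes>\<^sub>M gauss) gauss ?T) (Pi\<^sub>E UNIV A)
        = emeasure (gauss \<Otimes>\<^sub>M gauss) (?T -` Pi\<^sub>E UNIV A \<inter> space (gauss \<Otimes>\<^sub>M gauss))"
      by (rule emeasure_distr) auto
    also have "\<dots> = (\<integral>\<^sup>+z. emeasure gauss (Pair z -` (?T -` Pi\<^sub>E UNIV A \<inter> space (gauss \<Otimes>\<^sub>M gauss))) \<partial>gauss)"
      by (rule gauss.emeasure_pair_measure_alt) (auto intro!: measurable_sets[OF T])
    also have "\<dots> = (\<integral>\<^sup>+z. (\<Prod>k\<in>UNIV. emeasure ?N (S k (z k))) \<partial>gauss)"
    proof (rule nn_integral_cong)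
      fix z :: "'k \<Rightarrow> real"
      have "Pair z -` (?T -` Pi\<^sub>E UNIV A \<inter> space (gauss \<Otimes>\<^sub>M gauss)) = Pi\<^sub>E UNIV (\<lambda>k. S k (z k))"
        by (auto simp: space_pair_measure PiE_UNIV_domain S_def)
      thus "emeasure gauss (Pair z -` (?T -` Pi\<^sub>E UNIV A \<inter> space (gauss \<Otimes>\<^sub>M gauss)))
          = (\<Prod>k\<in>UNIV. emeasure ?N (S k (z k)))"
        unfolding gauss_def by (simp add: std_normals.emeasure_PiM)
    qed
    also have "\<dots> = (\<Prod>k\<in>UNIV. \<integral>\<^sup>+x. emeasure ?N (S k x) \<partial>?N)"
      unfolding gauss_def S_def
      by (rule std_normals.product_nn_integral_prod) (simp_all, measurable)
    also have "\<dots> = (\<Prod>k\<in>UNIV. emeasure ?N (A k))"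
    proof (rule prod.cong[OF refl])
      fix k
      let ?t = "\<lambda>(x, y). c k * x + d k * y"
      have "emeasure ?N (A k) = emeasure (distr (?N \<Otimes>\<^sub>M ?N) borel ?t) (A k)"
        by (simp only: std_normal_rotation[OF assms])
      also have "\<dots> = emeasure (?N \<Otimes>\<^sub>M ?N) (?t -` A k \<inter> space (?N \<Otimes>\<^sub>M ?N))"
        by (rule emeasure_distr) auto
      also have "\<dots> = (\<integral>\<^sup>+x. emeasure ?N (Pair x -` (?t -` A k \<inter> space (?N \<Otimes>\<^sub>M ?N))) \<partial>?N)"
        by (rule std_normal.emeasure_pair_measure_alt)
           (rule measurable_sets[where A = borel], auto)
      also have "\<dots> = (\<integral>\<^sup>+x. emeasure ?N (S k x) \<partial>?N)"
        by (rule nn_integral_cong)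
           (auto intro!: arg_cong[where f = "emeasure ?N"] simp: S_def space_pair_measure)
      finally show "(\<integral>\<^sup>+x. emeasure ?N (S k x) \<partial>?N) = emeasure ?N (A k)" ..
    qed
    finally show "emeasure (distr (gauss \<Otimes>\<^sub>M gauss) gauss ?T) (Pi\<^sub>E UNIV A)
       = (\<Prod>k\<in>UNIV. emeasure ?N (A k))" .
  qed simp
  thus ?thesis by (simp add: gauss_def)
qed

section \<open>Gaussian vectors\<close>

text \<open>
  Writing a Gaussian vector as a linear combination of independent standard normal coordinates makes
  measurability, moments and covariances consequences of the coefficients \<open>v\<close>.
\<close>
definition gauss_vector :: "('k::finite \<Rightarrow> 'e::real_vector) \<Rightarrow> ('k \<Rightarrow> real) \<Rightarrow> 'e" where
  "gauss_vector v z = (\<Sum>k\<in>UNIV. z k *\<^sub>R v k)"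

lemma gauss_vector_measurable [measurable]:
  fixes v :: "'k::finite \<Rightarrow> 'e::euclidean_space"
  shows "gauss_vector v \<in> borel_measurable gauss"
  unfolding gauss_vector_def by measurable

lemma norm_gauss_vector_le:
  fixes v :: "'k::finite \<Rightarrow> 'e::real_normed_vector"
  shows "norm (gauss_vector v z) \<le> (\<Sum>k\<in>UNIV. norm (v k)) * (\<Sum>k\<in>UNIV. \<bar>z k\<bar>)"
proof -
  have "norm (gauss_vector v z) \<le> (\<Sum>k\<in>UNIV. \<bar>z k\<bar> * norm (v k))"
    unfolding gauss_vector_def by (rule norm_sum[THEN order_trans]) simp
  also have "\<dots> \<le> (\<Sum>k\<in>UNIV. \<bar>z k\<bar> * (\<Sum>k\<in>UNIV. norm (v k)))"
    by (intro sum_mono mult_left_mono member_le_sum) auto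
  finally show ?thesis by (simp add: mult.commute flip: sum_distrib_right)
qed

lemma integrable_gauss_polynomial_growth:
  fixes f :: "('k::finite \<Rightarrow> real) \<Rightarrow> real"
  assumes [measurable]: "f \<in> borel_measurable gauss"
  and "\<And>z. \<bar>f z\<bar> \<le> c * (1 + (\<Sum>k\<in>UNIV. \<bar>z k\<bar>) ^ 3)"
  shows "integrable gauss f"
proof (rule Bochner_Integration.integrable_bound)
  show "integrable gauss (\<lambda>z. c * (1 + (\<Sum>k\<in>UNIV. \<bar>z (k::'k)\<bar>) ^ 3))"
    by (intro integrable_mult_right Bochner_Integration.integrable_add
        integrable_gauss_abs_sum_cubed) simp
  show "AE z in gauss. norm (f z) \<le> norm (c * (1 + (\<Sum>k\<in>UNIV. \<bar>z k\<bar>) ^ 3))"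
    using assms(2) by (auto intro: order_trans[OF _ abs_ge_self])
qed auto

lemma gauss_vector_sum_norm_bound:
  fixes v :: "'i \<Rightarrow> 'k::finite \<Rightarrow> 'e::real_normed_vector"
  shows "(\<Sum>i\<in>I. norm (gauss_vector (v i) z))
    \<le> (\<Sum>i\<in>I. \<Sum>k\<in>UNIV. norm (v i k)) * (\<Sum>k\<in>UNIV. \<bar>z k\<bar>)"
  unfolding sum_distrib_right by (intro sum_mono norm_gauss_vector_le[THEN order_trans])
    (simp add: sum_distrib_right)

lemma power_le_one_plus_cube:
  fixes x :: real assumes "x \<ge> 0" "n \<le> 3" shows "x ^ n \<le> 1 + x ^ 3"
proof (cases "x \<le> 1")
  case True
  thus ?thesis using assms power_le_one[of x n] zero_le_power[of x 3] by linarith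
next
  case False
  thus ?thesis using assms power_increasing[of n 3 x] by linarith
qed

lemma integrable_gauss_sum_norm_power:
  fixes v :: "'i \<Rightarrow> 'k::finite \<Rightarrow> 'e::euclidean_space"
  assumes "n \<le> 3"
  shows "integrable gauss (\<lambda>z. (\<Sum>i\<in>I. norm (gauss_vector (v i) z)) ^ n)"
proof (rule integrable_gauss_polynomial_growth)
  let ?c = "\<Sum>i\<in>I. \<Sum>k\<in>UNIV. norm (v i k)"
  fix z :: "'k \<Rightarrow> real"
  let ?S = "\<Sum>k\<in>UNIV. \<bar>z k\<bar>"
  have "(\<Sum>i\<in>I. norm (gauss_vector (v i) z)) ^ n \<le> (?c * ?S) ^ n"
    by (intro power_mono gauss_vector_sum_norm_bound sum_nonneg) auto
  also have "\<dots> = ?c ^ n * ?S ^ n" by (rule power_mult_distrib)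
  also have "\<dots> \<le> ?c ^ n * (1 + ?S ^ 3)"
    by (intro mult_left_mono power_le_one_plus_cube assms zero_le_power sum_nonneg) auto
  finally show "\<bar>(\<Sum>i\<in>I. norm (gauss_vector (v i) z)) ^ n\<bar> \<le> ?c ^ n * (1 + ?S ^ 3)"
    by (simp add: sum_nonneg)
qed measurable

lemma integrable_gauss_norm_power:
  fixes v :: "'k::finite \<Rightarrow> 'e::euclidean_space"
  assumes "n \<le> 3"
  shows "integrable gauss (\<lambda>z. norm (gauss_vector v z) ^ n)"
  using integrable_gauss_sum_norm_power[OF assms, of "\<lambda>_. v" "{()}"] by simp

lemma integrable_gauss_inner:
  fixes v w :: "'k::finite \<Rightarrow> 'e::euclidean_space"
  shows "integrable gauss (\<lambda>z. a \<bullet> gauss_vector v z)"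
    and "integrable gauss (\<lambda>z. (a \<bullet> gauss_vector v z) * (b \<bullet> gauss_vector w z))"
proof -
  show "integrable gauss (\<lambda>z. a \<bullet> gauss_vector v z)"
  proof (rule Bochner_Integration.integrable_bound)
    show "integrable gauss (\<lambda>z. norm a * norm (gauss_vector v z) ^ 1)"
      by (intro integrable_mult_right integrable_gauss_norm_power) simp
    show "AE z in gauss. norm (a \<bullet> gauss_vector v z) \<le> norm (norm a * norm (gauss_vector v z) ^ 1)"
      by (auto simp: Cauchy_Schwarz_ineq2)
  qed measurable
  show "integrable gauss (\<lambda>z. (a \<bullet> gauss_vector v z) * (b \<bullet> gauss_vector w z))"
  proof (rule Bochner_Integration.integrable_bound)
    show "integrable gauss (\<lambda>z. norm a * norm b *
            ((norm (gauss_vector v z))\<^sup>2 + (norm (gauss_vector w z))\<^sup>2))"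
      by (intro integrable_mult_right Bochner_Integration.integrable_add
            integrable_gauss_norm_power) simp_all
    have "\<bar>(a \<bullet> x) * (b \<bullet> y)\<bar> \<le> norm a * norm b * ((norm x)\<^sup>2 + (norm y)\<^sup>2)" for x y :: 'e
    proof -
      have "\<bar>(a \<bullet> x) * (b \<bullet> y)\<bar> \<le> (norm a * norm x) * (norm b * norm y)"
        unfolding abs_mult by (intro mult_mono Cauchy_Schwarz_ineq2) auto
      also have "\<dots> = norm a * norm b * (norm x * norm y)" by simp
      also have "norm x * norm y \<le> (norm x)\<^sup>2 + (norm y)\<^sup>2"
        using sum_squares_bound[of "norm x" "norm y"] mult_nonneg_nonneg[OF norm_ge_zero norm_ge_zero, of x y]
        by (simp only: mult.assoc)
      finally show ?thesis by (simp add: mult_left_mono)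
    qed
    thus "AE z in gauss. norm ((a \<bullet> gauss_vector v z) * (b \<bullet> gauss_vector w z))
        \<le> norm (norm a * norm b * ((norm (gauss_vector v z))\<^sup>2 + (norm (gauss_vector w z))\<^sup>2))"
      by (auto intro: order_trans[OF _ abs_ge_self])
  qed measurable
qed

lemma integral_gauss_inner:
  fixes v w :: "'k::finite \<Rightarrow> 'e::euclidean_space"
  shows "(\<integral>z. a \<bullet> gauss_vector v z \<partial>gauss) = 0"
    and "(\<integral>z. (a \<bullet> gauss_vector v z) * (b \<bullet> gauss_vector w z) \<partial>gauss)
          = (\<Sum>k\<in>UNIV. (a \<bullet> v k) * (b \<bullet> w k))"
proof -
  have eq: "a \<bullet> gauss_vector v z = (\<Sum>k\<in>UNIV. (a \<bullet> v k) * z k)"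
    for a and v :: "'k \<Rightarrow> 'e" and z
    by (simp add: gauss_vector_def inner_sum_right mult.commute)
  show "(\<integral>z. a \<bullet> gauss_vector v z \<partial>gauss) = 0"
    unfolding eq by (rule gauss_linear_form)
  show "(\<integral>z. (a \<bullet> gauss_vector v z) * (b \<bullet> gauss_vector w z) \<partial>gauss)
          = (\<Sum>k\<in>UNIV. (a \<bullet> v k) * (b \<bullet> w k))"
    unfolding eq by (rule gauss_linear_form)
qed

lemma measurable_free_energy:
  fixes Y :: "'i \<Rightarrow> 'z \<Rightarrow> 'a::euclidean_space \<times> real"
  assumes "\<And>i. Y i \<in> borel_measurable M"
  shows "(\<lambda>z. free_energy I \<beta> s \<epsilon> (\<lambda>i. Y i z)) \<in> borel_measurable M"
proof -
  have 1: "(\<lambda>v::'a \<times> real. s * norm (fst v, \<epsilon>) + snd v) \<in> borel_measurable borel"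
    by (intro borel_measurable_continuous_onI continuous_intros)
  have 2 [measurable]: "(\<lambda>z. s * norm (fst (Y i z), \<epsilon>) + snd (Y i z)) \<in> borel_measurable M" for i
    by (rule measurable_compose[OF assms 1])
  show ?thesis unfolding free_energy_def log_sum_exp_def by measurable
qed

lemma integrable_free_energy:
  fixes v w :: "'i \<Rightarrow> 'k::finite \<Rightarrow> 'a::euclidean_space \<times> real"
  assumes "finite I" "I \<noteq> {}" "\<beta> > 0" "\<bar>s\<bar> = 1"
  shows "integrable gauss (\<lambda>z. free_energy I \<beta> s \<epsilon> (\<lambda>i. y i + a *\<^sub>R gauss_vector (v i) z + b *\<^sub>R gauss_vector (w i) z))"
    (is "integrable gauss ?f")
proof (rule Bochner_Integration.integrable_bound)
  let ?g = "\<lambda>z. \<bar>free_energy I \<beta> s \<epsilon> y\<bar> + 2 * \<beta> * (\<bar>a\<bar> * (\<Sum>i\<in>I. norm (gauss_vector (v i) z)) ^ 1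
        + \<bar>b\<bar> * (\<Sum>i\<in>I. norm (gauss_vector (w i) z)) ^ 1)"
  show "integrable gauss ?g"
    by (intro Bochner_Integration.integrable_add integrable_mult_right
        integrable_gauss_sum_norm_power) simp_all
  show "?f \<in> borel_measurable gauss"
    by (intro measurable_free_energy) measurable
  have "\<bar>?f z\<bar> \<le> ?g z" for z
  proof -
    have "(\<Sum>i\<in>I. norm (a *\<^sub>R gauss_vector (v i) z + b *\<^sub>R gauss_vector (w i) z))
        \<le> (\<Sum>i\<in>I. \<bar>a\<bar> * norm (gauss_vector (v i) z) + \<bar>b\<bar> * norm (gauss_vector (w i) z))"
      by (intro sum_mono norm_triangle_ineq[THEN order_trans]) simp
    also have "\<dots> = \<bar>a\<bar> * (\<Sum>i\<in>I. norm (gauss_vector (v i) z)) + \<bar>b\<bar> * (\<Sum>i\<in>I. norm (gauss_vector (w i) z))"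
      by (simp add: sum.distrib sum_distrib_left)
    finally have *: "2 * \<beta> * (\<Sum>i\<in>I. norm (a *\<^sub>R gauss_vector (v i) z + b *\<^sub>R gauss_vector (w i) z))
      \<le> 2 * \<beta> * (\<bar>a\<bar> * (\<Sum>i\<in>I. norm (gauss_vector (v i) z)) + \<bar>b\<bar> * (\<Sum>i\<in>I. norm (gauss_vector (w i) z)))"
      using assms(3) by (intro mult_left_mono) auto
    have "\<bar>?f z - free_energy I \<beta> s \<epsilon> y\<bar>
      \<le> 2 * \<beta> * (\<Sum>i\<in>I. norm (a *\<^sub>R gauss_vector (v i) z + b *\<^sub>R gauss_vector (w i) z))"
      using free_energy_shift[OF assms, of \<epsilon>
          "\<lambda>i. y i + a *\<^sub>R gauss_vector (v i) z + b *\<^sub>R gauss_vector (w i) z" \<epsilon> y]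
      by (simp add: add.assoc mult.left_commute)
    with * show ?thesis unfolding power_one_right by linarith
  qed
  thus "AE z in gauss. norm (?f z) \<le> norm (?g z)"
    by (auto intro: order_trans[OF _ abs_ge_self])
qed

section \<open>Comparison of infinitesimal Gaussian increments\<close>

lemma norm_fst_sq_eq_sum_Basis:
  fixes e :: "'a::euclidean_space \<times> real"
  shows "(norm (fst e))\<^sup>2 = (\<Sum>b\<in>Basis. ((b, 0) \<bullet> e) * ((b, 0) \<bullet> e))"
  by (simp add: power2_norm_eq_inner euclidean_inner[of "fst e" "fst e"] inner_prod_def inner_commute)

text \<open>
  The family \<open>(gauss_vector (v i))\<^sub>i\<close> has independent vector and scalar components; the covariance of the
  vector components is \<open>P i j\<close> times the identity, and that of the scalar components is \<open>Q i j\<close>.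
\<close>
definition covariance_kernels ::
  "('i \<Rightarrow> 'k::finite \<Rightarrow> 'a::euclidean_space \<times> real) \<Rightarrow> ('i \<Rightarrow> 'i \<Rightarrow> real) \<Rightarrow> ('i \<Rightarrow> 'i \<Rightarrow> real) \<Rightarrow> bool" where
  "covariance_kernels v P Q \<longleftrightarrow> (\<forall>i j a b. (\<Sum>k\<in>UNIV. (a \<bullet> v i k) * (b \<bullet> v j k))
       = (fst a \<bullet> fst b) * P i j + snd a * snd b * Q i j)"

text \<open>
  The second-order term of the Taylor expansion is a quadratic form in the Gaussian vectors, so its mean
  only involves \<open>P\<close> and \<open>Q\<close>. Outside the double sum only the diagonal values \<open>P i i\<close> and \<open>Q i i\<close> occur;
  this is why comparing two families with equal diagonals comes down to the double sum.
\<close>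
lemma free_energy_second_order_mean:
  fixes v :: "'i \<Rightarrow> 'k::finite \<Rightarrow> 'a::euclidean_space \<times> real"
  assumes kern: "covariance_kernels v P Q"
  fixes I :: "'i set" and p :: "'i \<Rightarrow> real" and y :: "'i \<Rightarrow> 'a \<times> real" and \<beta> s \<epsilon> :: real
  defines "n \<equiv> (\<lambda>i. slope s \<epsilon> (y i))"
  defines "q \<equiv> (\<lambda>z. (\<Sum>i\<in>I. p i * (\<beta> * curvature s \<epsilon> (y i) (gauss_vector (v i) z)
                        + (\<beta> * (n i \<bullet> gauss_vector (v i) z))\<^sup>2))
                     - (\<Sum>i\<in>I. p i * (\<beta> * (n i \<bullet> gauss_vector (v i) z)))\<^sup>2)"
  shows "integrable gauss q"
   and "integral\<^sup>L gauss q =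
      (\<Sum>i\<in>I. p i * (\<beta> * s * (real DIM('a) - (norm (fst (n i)))\<^sup>2) * P i i / norm (fst (y i), \<epsilon>)
                   + \<beta>\<^sup>2 * ((norm (fst (n i)))\<^sup>2 * P i i + Q i i)))
       - \<beta>\<^sup>2 * (\<Sum>i\<in>I. \<Sum>j\<in>I. p i * p j * ((fst (n i) \<bullet> fst (n j)) * P i j + Q i j))"
proof -
  let ?X = "\<lambda>i z. gauss_vector (v i) z"
  let ?N = "\<lambda>i. norm (fst (y i), \<epsilon>)"
  have cov: "(\<integral>z. (a \<bullet> ?X i z) * (b \<bullet> ?X j z) \<partial>gauss) = (fst a \<bullet> fst b) * P i j + snd a * snd b * Q i j"
    for a b i j
    using kern unfolding integral_gauss_inner(2) covariance_kernels_def by blast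
  have has: "has_bochner_integral gauss (\<lambda>z. (a \<bullet> ?X i z) * (b \<bullet> ?X j z))
       ((fst a \<bullet> fst b) * P i j + snd a * snd b * Q i j)" for a b i j
    using cov integrable_gauss_inner(2) by (auto simp: has_bochner_integral_iff)
  have snd_n: "snd (n i) = 1" for i by (simp add: n_def slope_def)
  \<comment> \<open>As a combination of products of linear forms, q can be integrated term by term.\<close>
  have q_eq: "q = (\<lambda>z. (\<Sum>i\<in>I. p i * (\<beta> * s / ?N i * ((\<Sum>b\<in>Basis. ((b, 0) \<bullet> ?X i z) * ((b, 0) \<bullet> ?X i z))
          - ((fst (n i), 0) \<bullet> ?X i z) * ((fst (n i), 0) \<bullet> ?X i z))
       + \<beta>\<^sup>2 * ((n i \<bullet> ?X i z) * (n i \<bullet> ?X i z))))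
       - \<beta>\<^sup>2 * (\<Sum>i\<in>I. \<Sum>j\<in>I. p i * p j * ((n i \<bullet> ?X i z) * (n j \<bullet> ?X j z))))"
  proof
    fix z
    have 1: "\<beta> * curvature s \<epsilon> (y i) (?X i z) = \<beta> * s / ?N i * ((\<Sum>b\<in>Basis. ((b, 0) \<bullet> ?X i z) * ((b, 0) \<bullet> ?X i z))
          - ((fst (n i), 0) \<bullet> ?X i z) * ((fst (n i), 0) \<bullet> ?X i z))" for i
      unfolding curvature_def norm_fst_sq_eq_sum_Basis n_def[symmetric]
      by (simp add: n_def inner_prod_def power2_eq_square)
    have 2: "(\<Sum>i\<in>I. p i * (\<beta> * (n i \<bullet> ?X i z)))\<^sup>2
       = \<beta>\<^sup>2 * (\<Sum>i\<in>I. \<Sum>j\<in>I. p i * p j * ((n i \<bullet> ?X i z) * (n j \<bullet> ?X j z)))"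
      unfolding power2_eq_square sum_product
      by (simp add: sum_distrib_left mult_ac)
    show "q z = (\<Sum>i\<in>I. p i * (\<beta> * s / ?N i * ((\<Sum>b\<in>Basis. ((b, 0) \<bullet> ?X i z) * ((b, 0) \<bullet> ?X i z))
          - ((fst (n i), 0) \<bullet> ?X i z) * ((fst (n i), 0) \<bullet> ?X i z))
       + \<beta>\<^sup>2 * ((n i \<bullet> ?X i z) * (n i \<bullet> ?X i z))))
       - \<beta>\<^sup>2 * (\<Sum>i\<in>I. \<Sum>j\<in>I. p i * p j * ((n i \<bullet> ?X i z) * (n j \<bullet> ?X j z)))"
      unfolding q_def 1 2 power_mult_distrib by (simp add: power2_eq_square)
  qed
  have "has_bochner_integral gauss q
     ((\<Sum>i\<in>I. p i * (\<beta> * s / ?N i * ((\<Sum>b\<in>(Basis::'a set). (fst (b, 0::real) \<bullet> fst (b, 0::real)) * P i i + snd (b, 0::real) * snd (b, 0::real) * Q i i)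
          - ((fst (fst (n i), 0::real) \<bullet> fst (fst (n i), 0::real)) * P i i + snd (fst (n i), 0::real) * snd (fst (n i), 0::real) * Q i i))
       + \<beta>\<^sup>2 * ((fst (n i) \<bullet> fst (n i)) * P i i + snd (n i) * snd (n i) * Q i i)))
       - \<beta>\<^sup>2 * (\<Sum>i\<in>I. \<Sum>j\<in>I. p i * p j * ((fst (n i) \<bullet> fst (n j)) * P i j + snd (n i) * snd (n j) * Q i j)))"
    unfolding q_eq
    by (intro has_bochner_integral_diff has_bochner_integral_sum has_bochner_integral_mult_right
           has_bochner_integral_add has)
  also have "\<dots> =
      ((\<Sum>i\<in>I. p i * (\<beta> * s * (real DIM('a) - (norm (fst (n i)))\<^sup>2) * P i i / norm (fst (y i), \<epsilon>)
                   + \<beta>\<^sup>2 * ((norm (fst (n i)))\<^sup>2 * P i i + Q i i)))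
       - \<beta>\<^sup>2 * (\<Sum>i\<in>I. \<Sum>j\<in>I. p i * p j * ((fst (n i) \<bullet> fst (n j)) * P i j + Q i j)))"
    by (simp add: snd_n power2_norm_eq_inner algebra_simps diff_divide_distrib)
  finally show "integrable gauss q" 
   "integral\<^sup>L gauss q =
      (\<Sum>i\<in>I. p i * (\<beta> * s * (real DIM('a) - (norm (fst (n i)))\<^sup>2) * P i i / norm (fst (y i), \<epsilon>)
                   + \<beta>\<^sup>2 * ((norm (fst (n i)))\<^sup>2 * P i i + Q i i)))
       - \<beta>\<^sup>2 * (\<Sum>i\<in>I. \<Sum>j\<in>I. p i * p j * ((fst (n i) \<bullet> fst (n j)) * P i j + Q i j))"
    by (auto simp: has_bochner_integral_iff)
qed

text \<open>
  The linear terms of both expansions have mean zero. The means of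
  the quadratic terms differ by \<open>\<beta>\<^sup>2 \<Sum>\<^sub>i\<^sub>j p\<^sub>i p\<^sub>j (Q i j - P i j) (1 - n\<^sub>i \<bullet> n\<^sub>j)\<close>, where \<open>n\<^sub>i\<close> is the
  vector part of the slope, and every term of this sum is nonnegative because \<open>|n\<^sub>i| \<le> 1\<close>. The constant
  \<open>C\<close> does not depend on \<open>y\<close>, so \<open>y\<close> may later be replaced by an independent random configuration.
\<close>
lemma gauss_increment_comparison:
  fixes v w :: "'i \<Rightarrow> 'k::finite \<Rightarrow> 'a::euclidean_space \<times> real" and \<beta> s \<epsilon> :: real
  assumes I: "finite I" "I \<noteq> {}" and par: "\<beta> > 0" "\<bar>s\<bar> = 1" "\<epsilon> > 0"
  and kern: "covariance_kernels v P Q" "covariance_kernels w Q P"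
  and diag: "\<And>i. P i i = Q i i" and le: "\<And>i j. P i j \<le> Q i j"
  obtains C where "\<And>\<eta> y. \<eta> \<ge> 0 \<Longrightarrow>
     (\<integral>z. free_energy I \<beta> s \<epsilon> (\<lambda>i. y i + \<eta> *\<^sub>R gauss_vector (v i) z) \<partial>gauss)
     \<le> (\<integral>z. free_energy I \<beta> s \<epsilon> (\<lambda>i. y i + \<eta> *\<^sub>R gauss_vector (w i) z) \<partial>gauss) + C * \<eta> ^ 3"
proof
  define c where "c = 3 * \<beta> / \<epsilon>\<^sup>2 + 12 * \<beta>\<^sup>2 / \<epsilon> + 48 * \<beta> ^ 3"
  define K where "K v z = c * (\<Sum>i\<in>I. norm (gauss_vector (v i) z)) ^ 3"
    for v :: "'i \<Rightarrow> 'k \<Rightarrow> 'a \<times> real" and z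
  have intK: "integrable gauss (K v)" for v
    unfolding K_def by (intro integrable_mult_right integrable_gauss_sum_norm_power) simp
  fix \<eta> :: real and y :: "'i \<Rightarrow> 'a \<times> real" assume \<eta>: "\<eta> \<ge> 0"
  define F where "F v z = free_energy I \<beta> s \<epsilon> (\<lambda>i. y i + \<eta> *\<^sub>R gauss_vector (v i) z)"
    for v :: "'i \<Rightarrow> 'k \<Rightarrow> 'a \<times> real" and z
  define p where "p = gibbs_weight I \<beta> s \<epsilon> y"
  define n where "n i = slope s \<epsilon> (y i)" for i
  define L where "L v z = (\<Sum>i\<in>I. p i * (\<beta> * (n i \<bullet> gauss_vector (v i) z)))"
    for v :: "'i \<Rightarrow> 'k \<Rightarrow> 'a \<times> real" and z
  define q where "q v z = (\<Sum>i\<in>I. p i * (\<beta> * curvature s \<epsilon> (y i) (gauss_vector (v i) z)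
                        + (\<beta> * (n i \<bullet> gauss_vector (v i) z))\<^sup>2))
                     - (\<Sum>i\<in>I. p i * (\<beta> * (n i \<bullet> gauss_vector (v i) z)))\<^sup>2"
    for v :: "'i \<Rightarrow> 'k \<Rightarrow> 'a \<times> real" and z
  have taylor: "\<bar>F v z - free_energy I \<beta> s \<epsilon> y - \<eta> * L v z - \<eta>\<^sup>2 / 2 * q v z\<bar> \<le> K v z * \<eta> ^ 3" for v z
    using free_energy_taylor[OF I par \<eta>, of y "\<lambda>i. gauss_vector (v i) z"]
    unfolding F_def L_def q_def K_def c_def p_def n_def .
  have intF: "integrable gauss (F v)" for v
    using integrable_free_energy[OF I par(1,2), of \<epsilon> y \<eta> v 0 v] unfolding F_def by simp
  have intL: "integrable gauss (L v)" for v
    unfolding L_def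
    by (intro Bochner_Integration.integrable_sum integrable_mult_right integrable_gauss_inner)
  have L0: "integral\<^sup>L gauss (L v) = 0" for v
    unfolding L_def
    by (subst Bochner_Integration.integral_sum)
       (auto intro!: integrable_mult_right integrable_gauss_inner simp: integral_gauss_inner)
  have q: "integrable gauss (q v)" "integral\<^sup>L gauss (q v) =
      (\<Sum>i\<in>I. p i * (\<beta> * s * (real DIM('a) - (norm (fst (n i)))\<^sup>2) * P i i / norm (fst (y i), \<epsilon>)
                   + \<beta>\<^sup>2 * ((norm (fst (n i)))\<^sup>2 * P i i + Q i i)))
       - \<beta>\<^sup>2 * (\<Sum>i\<in>I. \<Sum>j\<in>I. p i * p j * ((fst (n i) \<bullet> fst (n j)) * P i j + Q i j))"
    if "covariance_kernels v P Q" for v P Q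
    using free_energy_second_order_mean[where I = I and p = p and y = y and \<beta> = \<beta> and s = s and \<epsilon> = \<epsilon>, OF that]
    unfolding q_def n_def by auto
  have p0: "p i \<ge> 0" for i
    unfolding p_def gibbs_weight_def by (rule gibbs_nonneg)
  have "integral\<^sup>L gauss (q w) - integral\<^sup>L gauss (q v)
      = \<beta>\<^sup>2 * (\<Sum>i\<in>I. \<Sum>j\<in>I. p i * p j * ((Q i j - P i j) * (1 - fst (n i) \<bullet> fst (n j))))"
    unfolding q(2)[OF kern(1)] q(2)[OF kern(2)] diag
    by (simp add: algebra_simps sum_subtractf sum.distrib)
  also have "\<dots> \<ge> 0"
  proof (intro mult_nonneg_nonneg sum_nonneg p0)
    fix i j
    show "Q i j - P i j \<ge> 0" using le by simp
    have "fst (n i) \<bullet> fst (n j) \<le> norm (fst (n i)) * norm (fst (n j))" by (rule norm_cauchy_schwarz)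
    also have "\<dots> \<le> 1"
      unfolding n_def by (intro mult_le_one norm_fst_slope_le par norm_ge_zero)
    finally show "0 \<le> 1 - fst (n i) \<bullet> fst (n j)" by simp
  qed simp
  finally have hess: "integral\<^sup>L gauss (q v) \<le> integral\<^sup>L gauss (q w)" by simp
  have int_q: "integrable gauss (q v)" "integrable gauss (q w)"
    using q(1) kern by auto
  let ?c = "free_energy I \<beta> s \<epsilon> y"
  have "integral\<^sup>L gauss (F v) \<le> (\<integral>z. ?c + \<eta> * L v z + \<eta>\<^sup>2 / 2 * q v z + K v z * \<eta> ^ 3 \<partial>gauss)"
  proof (rule integral_mono)
    show "F v z \<le> ?c + \<eta> * L v z + \<eta>\<^sup>2 / 2 * q v z + K v z * \<eta> ^ 3" for z
      using taylor[of v z] by linarith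
  qed (intro Bochner_Integration.integrable_add Bochner_Integration.integrable_diff integrable_mult_right
        integrable_mult_left intF intL int_q intK gauss.integrable_const)+
  also have "\<dots> = ?c + \<eta>\<^sup>2 / 2 * integral\<^sup>L gauss (q v) + integral\<^sup>L gauss (K v) * \<eta> ^ 3"
    by (simp add: intL int_q intK L0 gauss.prob_space)
  also have "\<dots> \<le> ?c + \<eta>\<^sup>2 / 2 * integral\<^sup>L gauss (q w) + integral\<^sup>L gauss (K v) * \<eta> ^ 3"
    using hess by (simp add: mult_left_mono)
  also have "?c + \<eta>\<^sup>2 / 2 * integral\<^sup>L gauss (q w)
      = (\<integral>z. ?c + \<eta> * L w z + \<eta>\<^sup>2 / 2 * q w z - K w z * \<eta> ^ 3 \<partial>gauss) + integral\<^sup>L gauss (K w) * \<eta> ^ 3"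
    by (simp add: intL int_q intK L0 gauss.prob_space)
  also have "(\<integral>z. ?c + \<eta> * L w z + \<eta>\<^sup>2 / 2 * q w z - K w z * \<eta> ^ 3 \<partial>gauss) \<le> integral\<^sup>L gauss (F w)"
  proof (rule integral_mono)
    show "?c + \<eta> * L w z + \<eta>\<^sup>2 / 2 * q w z - K w z * \<eta> ^ 3 \<le> F w z" for z
      using taylor[of w z] by linarith
  qed (intro Bochner_Integration.integrable_add Bochner_Integration.integrable_diff integrable_mult_right
        integrable_mult_left intF intL int_q intK gauss.integrable_const)+
  finally show "(\<integral>z. free_energy I \<beta> s \<epsilon> (\<lambda>i. y i + \<eta> *\<^sub>R gauss_vector (v i) z) \<partial>gauss)
     \<le> (\<integral>z. free_energy I \<beta> s \<epsilon> (\<lambda>i. y i + \<eta> *\<^sub>R gauss_vector (w i) z) \<partial>gauss)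
       + (integral\<^sup>L gauss (K v) + integral\<^sup>L gauss (K w)) * \<eta> ^ 3"
    unfolding F_def by (simp add: algebra_simps)
qed

section \<open>Monotonicity along the interpolation\<close>

text \<open>
  Over \<open>n\<close> equal steps of total length \<open>d\<close> the errors add up to \<open>C d \<surd>(d / n)\<close>, which tends to \<open>0\<close>.
\<close>
lemma antimono_on_of_local_bound:
  fixes f :: "real \<Rightarrow> real"
  assumes step: "\<And>t h. 0 \<le> t \<Longrightarrow> h > 0 \<Longrightarrow> t + h \<le> 1 \<Longrightarrow> f (t + h) \<le> f t + C * sqrt h ^ 3"
  shows "antimono_on {0..1} f"
proof (rule monotone_onI)
  fix a b :: real assume ab: "a \<in> {0..1}" "b \<in> {0..1}" "a \<le> b"
  show "f b \<le> f a"
  proof (cases "a = b")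
    case False
    define d where "d = b - a"
    have d: "d > 0" using ab False by (simp add: d_def)
    have "f b \<le> f a + C * d * sqrt (d / real (Suc n))" for n
    proof -
      define h where "h = d / real (Suc n)"
      have h: "h > 0" and hn: "real (Suc n) * h = d" using d by (simp_all add: h_def)
      have "f (a + real j * h) \<le> f a + real j * (C * sqrt h ^ 3)" if "j \<le> Suc n" for j
        using that
      proof (induction j)
        case (Suc j)
        have "real (Suc j) * h \<le> real (Suc n) * h"
          using Suc.prems h by (intro mult_right_mono) auto
        hence "real j * h + h \<le> d" unfolding hn by (simp add: algebra_simps)
        hence "f (a + real j * h + h) \<le> f (a + real j * h) + C * sqrt h ^ 3"
          using ab h d by (intro step) (auto simp: d_def)
        with Suc show ?case by (simp add: algebra_simps)
      qed simp
      from this[of "Suc n"] have "f b \<le> f a + real (Suc n) * (C * sqrt h ^ 3)"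
        unfolding hn by (simp add: d_def)
      also have "sqrt h ^ 3 = h * sqrt h"
        using h by (simp add: power3_eq_cube)
      also have "real (Suc n) * (C * (h * sqrt h)) = C * d * sqrt h"
        unfolding hn[symmetric] by (simp only: mult_ac)
      finally show ?thesis unfolding h_def .
    qed
    moreover have "(\<lambda>n. f a + C * d * sqrt (d / real (Suc n))) \<longlonglongrightarrow> f a + C * d * sqrt 0"
      by (intro tendsto_intros LIMSEQ_Suc[OF lim_const_over_n])
    ultimately have "f b \<le> f a + C * d * sqrt 0"
      by (intro LIMSEQ_le_const) auto
    thus ?thesis by simp
  qed simp
qed

text \<open>
  The two families use disjoint sets of coordinates, so the coordinates in \<open>S\<close> can be rotated by the
  angle belonging to \<open>(a1, a2)\<close> and the others by the one belonging to \<open>(b1, b2)\<close>. A Gaussian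
  configuration is thereby split into two independent pieces.
\<close>
lemma gauss_split:
  fixes v w :: "'i \<Rightarrow> 'k::finite \<Rightarrow> 'e::euclidean_space" and \<Phi> :: "('i \<Rightarrow> 'e) \<Rightarrow> real"
  assumes supp: "\<forall>i. \<forall>k\<in>-S. v i k = 0" "\<forall>i. \<forall>k\<in>S. w i k = 0"
  and int: "integrable gauss (\<lambda>z. \<Phi> (\<lambda>i. a *\<^sub>R gauss_vector (v i) z + b *\<^sub>R gauss_vector (w i) z))"
  and sq: "a1\<^sup>2 + a2\<^sup>2 = a\<^sup>2" "b1\<^sup>2 + b2\<^sup>2 = b\<^sup>2"
  defines "g \<equiv> (\<lambda>z z'. \<Phi> (\<lambda>i. a1 *\<^sub>R gauss_vector (v i) z + b1 *\<^sub>R gauss_vector (w i) z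
                   + (a2 *\<^sub>R gauss_vector (v i) z' + b2 *\<^sub>R gauss_vector (w i) z')))"
  shows "integrable gauss (\<lambda>z. \<integral>z'. g z z' \<partial>gauss)"
    and "(\<integral>z. \<Phi> (\<lambda>i. a *\<^sub>R gauss_vector (v i) z + b *\<^sub>R gauss_vector (w i) z) \<partial>gauss)
          = (\<integral>z. (\<integral>z'. g z z' \<partial>gauss) \<partial>gauss)"
proof -
  \<comment> \<open>If a = 0, then a1 = a2 = 0, and any rotation will do; likewise for b.\<close>
  define c1 where "c1 k = (if k \<in> S then if a = 0 then 1 else a1 / a
                                    else if b = 0 then 1 else b1 / b)" for k
  define c2 where "c2 k = (if k \<in> S then if a = 0 then 0 else a2 / a
                                    else if b = 0 then 0 else b2 / b)" for k
  have c: "(c1 k)\<^sup>2 + (c2 k)\<^sup>2 = 1" for k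
    using sq by (auto simp: c1_def c2_def power_divide simp flip: add_divide_distrib)
  let ?T = "\<lambda>(z, z') k. c1 k * z k + c2 k * z' k :: real"
  let ?f = "\<lambda>z. \<Phi> (\<lambda>i. a *\<^sub>R gauss_vector (v i) z + b *\<^sub>R gauss_vector (w i) z)"
  have a: "a * c1 k = a1" "a * c2 k = a2" if "k \<in> S" for k
    using that sq(1) by (auto simp: c1_def c2_def)
  have b: "b * c1 k = b1" "b * c2 k = b2" if "k \<notin> S" for k
    using that sq(2) by (auto simp: c1_def c2_def)
  have V: "a *\<^sub>R gauss_vector (v i) (?T (z, z')) = a1 *\<^sub>R gauss_vector (v i) z + a2 *\<^sub>R gauss_vector (v i) z'" for i z z'
    unfolding gauss_vector_def scaleR_sum_right sum.distrib[symmetric]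
  proof (rule sum.cong[OF refl])
    fix k
    show "a *\<^sub>R (?T (z, z') k *\<^sub>R v i k) = a1 *\<^sub>R (z k *\<^sub>R v i k) + a2 *\<^sub>R (z' k *\<^sub>R v i k)"
      by (cases "k \<in> S") (auto simp: supp(1)[rule_format] a[symmetric] algebra_simps)
  qed
  have W: "b *\<^sub>R gauss_vector (w i) (?T (z, z')) = b1 *\<^sub>R gauss_vector (w i) z + b2 *\<^sub>R gauss_vector (w i) z'" for i z z'
    unfolding gauss_vector_def scaleR_sum_right sum.distrib[symmetric]
  proof (rule sum.cong[OF refl])
    fix k
    show "b *\<^sub>R (?T (z, z') k *\<^sub>R w i k) = b1 *\<^sub>R (z k *\<^sub>R w i k) + b2 *\<^sub>R (z' k *\<^sub>R w i k)"
      by (cases "k \<in> S") (auto simp: supp(2)[rule_format] b[symmetric] algebra_simps)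
  qed
  have fT: "?f (?T (z, z')) = g z z'" for z z'
    unfolding V W g_def by (simp add: algebra_simps)
  have T [measurable]: "?T \<in> gauss \<Otimes>\<^sub>M gauss \<rightarrow>\<^sub>M gauss"
    by (rule measurable_gauss_rotation)
  have rot: "distr (gauss \<Otimes>\<^sub>M gauss) gauss ?T = gauss"
    by (rule gauss_rotation[OF c])
  have "integrable (distr (gauss \<Otimes>\<^sub>M gauss) gauss ?T) ?f"
    unfolding rot by (rule int)
  hence "integrable (gauss \<Otimes>\<^sub>M gauss) (\<lambda>p. ?f (?T p))"
    using int by (subst (asm) integrable_distr_eq) auto
  hence int2: "integrable (gauss \<Otimes>\<^sub>M gauss) (\<lambda>(z, z'). g z z')"
    by (simp add: fT[symmetric] case_prod_beta')
  show "integrable gauss (\<lambda>z. \<integral>z'. g z z' \<partial>gauss)"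
    using gauss2.integrable_fst[OF int2] .
  have "integral\<^sup>L gauss ?f = integral\<^sup>L (distr (gauss \<Otimes>\<^sub>M gauss) gauss ?T) ?f"
    unfolding rot ..
  also have "\<dots> = (\<integral>p. ?f (?T p) \<partial>(gauss \<Otimes>\<^sub>M gauss))"
    using int by (intro integral_distr T) auto
  also have "\<dots> = (\<integral>p. (\<lambda>(z, z'). g z z') p \<partial>(gauss \<Otimes>\<^sub>M gauss))"
    by (simp add: fT[symmetric] case_prod_beta')
  also have "\<dots> = (\<integral>z. (\<integral>z'. g z z' \<partial>gauss) \<partial>gauss)"
    using gauss2.integral_fst[OF int2] by simp
  finally show "integral\<^sup>L gauss ?f = (\<integral>z. (\<integral>z'. g z z' \<partial>gauss) \<partial>gauss)" .
qed

text \<open>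
  The configurations at times \<open>t + h\<close> and \<open>t\<close> share the part \<open>\<surd>t A + \<surd>(1 - t - h) B\<close>. What remains is
  \<open>\<surd>h A'\<close> in the first case and \<open>\<surd>h B'\<close> in the second, with \<open>A'\<close> and \<open>B'\<close> independent of the shared
  part, and these increments have just been compared for every value of the shared part.
\<close>
lemma smoothed_interpolation_antimono:
  fixes v w :: "'i \<Rightarrow> 'k::finite \<Rightarrow> 'a::euclidean_space \<times> real" and \<beta> s \<epsilon> :: real
  assumes I: "finite I" "I \<noteq> {}" and par: "\<beta> > 0" "\<bar>s\<bar> = 1" "\<epsilon> > 0"
  and supp: "\<forall>i. \<forall>k\<in>-S. v i k = 0" "\<forall>i. \<forall>k\<in>S. w i k = 0"
  and kern: "covariance_kernels v P Q" "covariance_kernels w Q P"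
  and diag: "\<And>i. P i i = Q i i" and le: "\<And>i j. P i j \<le> Q i j"
  shows "antimono_on {0..1} (\<lambda>t. \<integral>z. free_energy I \<beta> s \<epsilon>
           (\<lambda>i. sqrt t *\<^sub>R gauss_vector (v i) z + sqrt (1 - t) *\<^sub>R gauss_vector (w i) z) \<partial>gauss)"
proof -
  let ?\<Phi> = "free_energy I \<beta> s \<epsilon> :: ('i \<Rightarrow> 'a \<times> real) \<Rightarrow> real"
  obtain C where C: "\<And>\<eta> y. \<eta> \<ge> 0 \<Longrightarrow>
     (\<integral>z. ?\<Phi> (\<lambda>i. y i + \<eta> *\<^sub>R gauss_vector (v i) z) \<partial>gauss)
     \<le> (\<integral>z. ?\<Phi> (\<lambda>i. y i + \<eta> *\<^sub>R gauss_vector (w i) z) \<partial>gauss) + C * \<eta> ^ 3"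
    using gauss_increment_comparison[OF I par kern diag le] by blast
  have int: "integrable gauss (\<lambda>z. ?\<Phi> (\<lambda>i. a *\<^sub>R gauss_vector (v i) z + b *\<^sub>R gauss_vector (w i) z))" for a b
    using integrable_free_energy[OF I par(1,2), of \<epsilon> "\<lambda>_. 0" a v b w] by simp
  note split = gauss_split[where S = S and v = v and w = w, OF supp int]
  show ?thesis
  proof (rule antimono_on_of_local_bound)
    fix t h :: real assume th: "0 \<le> t" "h > 0" "t + h \<le> 1"
    let ?Y = "\<lambda>z i. sqrt t *\<^sub>R gauss_vector (v i) z + sqrt (1 - t - h) *\<^sub>R gauss_vector (w i) z"
    have 1: "(sqrt t)\<^sup>2 + (sqrt h)\<^sup>2 = (sqrt (t + h))\<^sup>2"
      "(sqrt (1 - t - h))\<^sup>2 + 0\<^sup>2 = (sqrt (1 - (t + h)))\<^sup>2"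
      using th by auto
    have 2: "(sqrt t)\<^sup>2 + 0\<^sup>2 = (sqrt t)\<^sup>2"
      "(sqrt (1 - t - h))\<^sup>2 + (sqrt h)\<^sup>2 = (sqrt (1 - t))\<^sup>2"
      using th by auto
    note s1 = split[OF 1] and s2 = split[OF 2]
    have "(\<integral>z. (\<integral>z'. ?\<Phi> (\<lambda>i. ?Y z i + sqrt h *\<^sub>R gauss_vector (v i) z') \<partial>gauss) \<partial>gauss)
      \<le> (\<integral>z. (\<integral>z'. ?\<Phi> (\<lambda>i. ?Y z i + sqrt h *\<^sub>R gauss_vector (w i) z') \<partial>gauss) + C * sqrt h ^ 3 \<partial>gauss)"
    proof (rule integral_mono)
      show "integrable gauss (\<lambda>z. \<integral>z'. ?\<Phi> (\<lambda>i. ?Y z i + sqrt h *\<^sub>R gauss_vector (v i) z') \<partial>gauss)"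
        using s1(1) by simp
      show "integrable gauss (\<lambda>z. (\<integral>z'. ?\<Phi> (\<lambda>i. ?Y z i + sqrt h *\<^sub>R gauss_vector (w i) z') \<partial>gauss) + C * sqrt h ^ 3)"
        using s2(1) by (intro Bochner_Integration.integrable_add) auto
      show "(\<integral>z'. ?\<Phi> (\<lambda>i. ?Y z i + sqrt h *\<^sub>R gauss_vector (v i) z') \<partial>gauss)
        \<le> (\<integral>z'. ?\<Phi> (\<lambda>i. ?Y z i + sqrt h *\<^sub>R gauss_vector (w i) z') \<partial>gauss) + C * sqrt h ^ 3" for z
        using th by (intro C) auto
    qed
    also have "\<dots> = (\<integral>z. (\<integral>z'. ?\<Phi> (\<lambda>i. ?Y z i + sqrt h *\<^sub>R gauss_vector (w i) z') \<partial>gauss) \<partial>gauss) + C * sqrt h ^ 3"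
      using s2(1) by (subst Bochner_Integration.integral_add) (auto simp: gauss.prob_space)
    finally show "(\<integral>z. ?\<Phi> (\<lambda>i. sqrt (t + h) *\<^sub>R gauss_vector (v i) z + sqrt (1 - (t + h)) *\<^sub>R gauss_vector (w i) z) \<partial>gauss)
      \<le> (\<integral>z. ?\<Phi> (\<lambda>i. sqrt t *\<^sub>R gauss_vector (v i) z + sqrt (1 - t) *\<^sub>R gauss_vector (w i) z) \<partial>gauss) + C * sqrt h ^ 3"
      using s1(2) s2(2) by simp
  qed
qed

text \<open>
  Smoothing changes the expectation by at most \<open>\<beta> \<epsilon>\<close>, uniformly in \<open>t\<close>, so the monotonicity of the
  smoothed expectations survives the limit \<open>\<epsilon> \<rightarrow> 0\<close>.
\<close>
theorem interpolation_antimono: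
  fixes v w :: "'i \<Rightarrow> 'k::finite \<Rightarrow> 'a::euclidean_space \<times> real" and \<beta> s :: real
  assumes I: "finite I" "I \<noteq> {}" and par: "\<beta> > 0" "\<bar>s\<bar> = 1"
  and supp: "\<forall>i. \<forall>k\<in>-S. v i k = 0" "\<forall>i. \<forall>k\<in>S. w i k = 0"
  and kern: "covariance_kernels v P Q" "covariance_kernels w Q P"
  and diag: "\<And>i. P i i = Q i i" and le: "\<And>i j. P i j \<le> Q i j"
  shows "antimono_on {0..1} (\<lambda>t. \<integral>z. free_energy I \<beta> s 0
           (\<lambda>i. sqrt t *\<^sub>R gauss_vector (v i) z + sqrt (1 - t) *\<^sub>R gauss_vector (w i) z) \<partial>gauss)"
proof -
  let ?Y = "\<lambda>t z i. sqrt t *\<^sub>R gauss_vector (v i) z + sqrt (1 - t) *\<^sub>R gauss_vector (w i) z"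
  define \<psi> where "\<psi> \<epsilon> t = (\<integral>z. free_energy I \<beta> s \<epsilon> (?Y t z) \<partial>gauss)" for \<epsilon> t
  have int: "integrable gauss (\<lambda>z. free_energy I \<beta> s \<epsilon> (?Y t z))" for \<epsilon> t
    using integrable_free_energy[OF I par(1,2), of \<epsilon> "\<lambda>_. 0" "sqrt t" v "sqrt (1 - t)" w] by simp
  have shift: "\<psi> \<epsilon> t \<le> \<psi> \<epsilon>' t + \<beta> * \<bar>\<epsilon> - \<epsilon>'\<bar>" for \<epsilon> \<epsilon>' t
  proof -
    have "\<psi> \<epsilon> t \<le> (\<integral>z. free_energy I \<beta> s \<epsilon>' (?Y t z) + \<beta> * \<bar>\<epsilon> - \<epsilon>'\<bar> \<partial>gauss)"
      unfolding \<psi>_def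
    proof (rule integral_mono)
      show "free_energy I \<beta> s \<epsilon> (?Y t z) \<le> free_energy I \<beta> s \<epsilon>' (?Y t z) + \<beta> * \<bar>\<epsilon> - \<epsilon>'\<bar>" for z
        using free_energy_shift[OF I par, of \<epsilon> "?Y t z" \<epsilon>' "?Y t z"] by simp
    qed (auto intro!: int)
    thus ?thesis by (simp add: \<psi>_def int gauss.prob_space)
  qed
  have "antimono_on {0..1} (\<psi> 0)"
  proof (rule monotone_onI)
    fix a b :: real assume ab: "a \<in> {0..1}" "b \<in> {0..1}" "a \<le> b"
    show "\<psi> 0 b \<le> \<psi> 0 a"
    proof (rule field_le_epsilon)
      fix e :: real assume "e > 0"
      define \<epsilon> where "\<epsilon> = e / (2 * \<beta>)"
      have \<epsilon>: "\<epsilon> > 0" "\<beta> * \<epsilon> = e / 2" using \<open>e > 0\<close> par(1) by (auto simp: \<epsilon>_def)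
      have "\<psi> \<epsilon> b \<le> \<psi> \<epsilon> a"
        using smoothed_interpolation_antimono[where S = S, OF I par \<epsilon>(1) supp kern diag le] ab
        unfolding \<psi>_def by (auto simp: monotone_on_def)
      with shift[of 0 b \<epsilon>] shift[of \<epsilon> a 0] \<epsilon> show "\<psi> 0 b \<le> \<psi> 0 a + e" by simp
    qed
  qed
  thus ?thesis unfolding \<psi>_def .
qed

section \<open>The matrix model\<close>

lemma entry_index_UNIV:
  "(UNIV :: ('m, 'n) entry_index set)
     = range (\<lambda>(i, j). Ent_G i j) \<union> range Ent_u2 \<union> range Ent_h \<union> {Ent_u4}"
proof -
  have "k \<in> range (\<lambda>(i, j). Ent_G i j) \<union> range Ent_u2 \<union> range Ent_h \<union> {Ent_u4}"
    for k :: "('m, 'n) entry_index"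
    by (cases k) (auto simp: image_iff)
  thus ?thesis by blast
qed

instance entry_index :: (finite, finite) finite
  by standard (simp add: entry_index_UNIV)

lemma sum_entry_index:
  fixes f :: "('m::finite, 'n::finite) entry_index \<Rightarrow> 'b::comm_monoid_add"
  shows "(\<Sum>k\<in>UNIV. f k) = (\<Sum>i\<in>UNIV. \<Sum>j\<in>UNIV. f (Ent_G i j)) + (\<Sum>i\<in>UNIV. f (Ent_u2 i))
           + (\<Sum>j\<in>UNIV. f (Ent_h j)) + f Ent_u4"
proof -
  have "(\<Sum>k\<in>range (\<lambda>(i, j). Ent_G i j). f k) = (\<Sum>i\<in>UNIV. \<Sum>j\<in>UNIV. f (Ent_G i j))"
    by (subst sum.reindex) (auto simp: inj_on_def sum.cartesian_product case_prod_beta')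
  moreover have "(\<Sum>k\<in>range Ent_u2. f k) = (\<Sum>i\<in>UNIV. f (Ent_u2 i))"
    "(\<Sum>k\<in>range Ent_h. f k) = (\<Sum>j\<in>UNIV. f (Ent_h j))"
    by (subst sum.reindex; auto simp: inj_on_def)+
  ultimately show ?thesis
    unfolding entry_index_UNIV
    by (subst sum.union_disjoint; force?)+
qed

text \<open>
  The coefficients, in the scalar entries, of \<open>(G x, |x| u4)\<close>, which is the configuration at \<open>t = 1\<close>.
\<close>
definition matrix_endpoint_coeff :: "real^'n \<Rightarrow> ('m::finite, 'n::finite) entry_index \<Rightarrow> (real^'m) \<times> real" where
  "matrix_endpoint_coeff x k = (case k of Ent_G i j \<Rightarrow> ((x $ j) *\<^sub>R axis i 1, 0)
     | Ent_u2 i \<Rightarrow> 0 | Ent_h j \<Rightarrow> 0 | Ent_u4 \<Rightarrow> (0, norm x))"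

text \<open>
  The coefficients, in the scalar entries, of \<open>(|x| u2, h \<bullet> x)\<close>, which is the configuration at \<open>t = 0\<close>.
\<close>
definition vector_endpoint_coeff :: "real^'n \<Rightarrow> ('m::finite, 'n::finite) entry_index \<Rightarrow> (real^'m) \<times> real" where
  "vector_endpoint_coeff x k = (case k of Ent_G i j \<Rightarrow> 0
     | Ent_u2 i \<Rightarrow> (norm x *\<^sub>R axis i 1, 0) | Ent_h j \<Rightarrow> (0, x $ j) | Ent_u4 \<Rightarrow> 0)"

lemma gauss_vector_matrix_endpoint:
  fixes x :: "real^'n" and G :: "'w \<Rightarrow> real^'n^'m"
  shows "gauss_vector (matrix_endpoint_coeff x) (\<lambda>k. gaussian_entry G u2 h u4 k \<omega>) = (G \<omega> *v x, norm x * u4 \<omega>)"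
proof -
  have [simp]: "(\<Sum>p\<in>UNIV. \<Sum>q\<in>UNIV. if i = p then f p q else 0) = (\<Sum>q\<in>UNIV. f i q)"
    for i :: 'm and f :: "'m \<Rightarrow> 'n \<Rightarrow> real"
    by (subst sum.swap) simp
  show ?thesis
    unfolding gauss_vector_def sum_entry_index matrix_endpoint_coeff_def
    by (auto simp: prod_eq_iff fst_sum snd_sum vec_eq_iff matrix_vector_mult_def axis_def
         if_distrib if_distribR sum.delta cong: if_cong)
qed

lemma gauss_vector_vector_endpoint:
  fixes x :: "real^'n" and G :: "'w \<Rightarrow> real^'n^'m"
  shows "gauss_vector (vector_endpoint_coeff x) (\<lambda>k. gaussian_entry G u2 h u4 k \<omega>) = (norm x *\<^sub>R u2 \<omega>, h \<omega> \<bullet> x)"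
  unfolding gauss_vector_def sum_entry_index vector_endpoint_coeff_def
  by (auto simp: prod_eq_iff fst_sum snd_sum vec_eq_iff inner_vec_def axis_def
       if_distrib if_distribR sum.delta cong: if_cong)

lemma covariance_kernels_matrix_endpoint:
  fixes x :: "'i \<Rightarrow> real^'n"
  shows "covariance_kernels (\<lambda>i. matrix_endpoint_coeff (x i) :: ('m::finite, 'n) entry_index \<Rightarrow> (real^'m) \<times> real)
           (\<lambda>i j. x i \<bullet> x j) (\<lambda>i j. norm (x i) * norm (x j))"
  unfolding covariance_kernels_def
proof (intro allI)
  fix i j and a b :: "(real^'m) \<times> real"
  have "(\<Sum>p\<in>UNIV. \<Sum>q\<in>UNIV. (x i $ q * fst a $ p) * (x j $ q * fst b $ p)) = (fst a \<bullet> fst b) * (x i \<bullet> x j)"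
    unfolding inner_vec_def sum_product by (intro sum.cong refl) (simp add: mult_ac)
  thus "(\<Sum>k\<in>UNIV. (a \<bullet> (matrix_endpoint_coeff (x i) k)) * (b \<bullet> matrix_endpoint_coeff (x j) k))
       = (fst a \<bullet> fst b) * (x i \<bullet> x j) + snd a * snd b * (norm (x i) * norm (x j))"
    unfolding sum_entry_index matrix_endpoint_coeff_def
    by (simp add: inner_prod_def inner_axis mult_ac)
qed

lemma covariance_kernels_vector_endpoint:
  fixes x :: "'i \<Rightarrow> real^'n"
  shows "covariance_kernels (\<lambda>i. vector_endpoint_coeff (x i) :: ('m::finite, 'n) entry_index \<Rightarrow> (real^'m) \<times> real)
           (\<lambda>i j. norm (x i) * norm (x j)) (\<lambda>i j. x i \<bullet> x j)"
  unfolding covariance_kernels_def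
proof (intro allI)
  fix i j and a b :: "(real^'m) \<times> real"
  have "(\<Sum>p\<in>UNIV. (norm (x i) * fst a $ p) * (norm (x j) * fst b $ p)) = (fst a \<bullet> fst b) * (norm (x i) * norm (x j))"
    unfolding inner_vec_def sum_distrib_right by (intro sum.cong refl) (simp add: mult_ac)
  moreover have "(\<Sum>q\<in>UNIV. (snd a * x i $ q) * (snd b * x j $ q)) = snd a * snd b * (x i \<bullet> x j)"
    unfolding inner_vec_def sum_distrib_left by (intro sum.cong refl) (simp add: mult_ac)
  ultimately show "(\<Sum>k\<in>UNIV. (a \<bullet> (vector_endpoint_coeff (x i) k)) * (b \<bullet> vector_endpoint_coeff (x j) k))
       = (fst a \<bullet> fst b) * (norm (x i) * norm (x j)) + snd a * snd b * (x i \<bullet> x j)"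
    unfolding sum_entry_index vector_endpoint_coeff_def
    by (simp add: inner_prod_def inner_axis mult_ac)
qed

lemma distr_gaussian_entries:
  fixes G :: "'w \<Rightarrow> real^'n^'m" and u2 h u4
  defines "X \<equiv> (\<lambda>\<omega> k. gaussian_entry G u2 h u4 k \<omega>)"
  assumes "prob_space M" "indep_std_gaussians M G u2 h u4"
  shows "X \<in> M \<rightarrow>\<^sub>M gauss" and "distr M gauss X = gauss"
proof -
  interpret prob_space M by fact
  let ?e = "gaussian_entry G u2 h u4"
  have indep: "indep_vars (\<lambda>_. borel) ?e UNIV"
    and d: "distributed M lborel (?e k) std_normal_density" for k
    using assms(3) unfolding indep_std_gaussians_def by auto
  have m [measurable]: "?e k \<in> borel_measurable M" for k
    using distributed_measurable[OF d[of k]] by simp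
  have "X \<in> M \<rightarrow>\<^sub>M PiM UNIV (\<lambda>_. borel)"
    unfolding X_def by (rule measurable_PiM_single') auto
  thus X: "X \<in> M \<rightarrow>\<^sub>M gauss" by simp
  have e: "distr M borel (?e k) = std_normal_distribution" for k
  proof -
    have "distr M borel (?e k) = distr M lborel (?e k)" by (intro distr_cong) auto
    thus ?thesis using distributed_distr_eq_density[OF d[of k]] by simp
  qed
  have "distr M gauss X = distr M (PiM UNIV (\<lambda>_. borel)) (\<lambda>\<omega>. \<lambda>k\<in>UNIV. ?e k \<omega>)"
    by (intro distr_cong) (auto simp: X_def sets_gauss)
  also have "\<dots> = PiM UNIV (\<lambda>k. distr M borel (?e k))"
    using indep by (subst (asm) indep_vars_iff_distr_eq_PiM) auto
  also have "\<dots> = gauss" unfolding e gauss_def ..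
  finally show "distr M gauss X = gauss" .
qed

text \<open>
  The expectation depends only on the joint law of the scalar entries, which is the standard Gaussian
  measure.
\<close>
lemma psi_M_eq_gauss_integral:
  fixes M :: "'w measure"
    and G :: "'w \<Rightarrow> real^'n^'m" and u2 :: "'w \<Rightarrow> real^'m"
    and h :: "'w \<Rightarrow> real^'n" and u4 :: "'w \<Rightarrow> real" and x :: "nat \<Rightarrow> real^'n"
  assumes "prob_space M" "indep_std_gaussians M G u2 h u4"
  shows "psi_M M G u2 h u4 l x \<beta> s t = 1 / (\<beta> * sqrt (real CARD('n))) *
    (\<integral>z. free_energy {1..l} \<beta> s 0 (\<lambda>i. sqrt t *\<^sub>R gauss_vector (matrix_endpoint_coeff (x i)) z
        + sqrt (1 - t) *\<^sub>R gauss_vector (vector_endpoint_coeff (x i) :: ('m, 'n) entry_index \<Rightarrow> _) z) \<partial>gauss)"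
proof -
  let ?F = "\<lambda>z. free_energy {1..l} \<beta> s 0 (\<lambda>i. sqrt t *\<^sub>R gauss_vector (matrix_endpoint_coeff (x i)) z
        + sqrt (1 - t) *\<^sub>R gauss_vector (vector_endpoint_coeff (x i) :: ('m, 'n) entry_index \<Rightarrow> _) z)"
  let ?X = "\<lambda>\<omega> k. gaussian_entry G u2 h u4 k \<omega>"
  note X = distr_gaussian_entries[OF assms]
  have "?F \<in> borel_measurable gauss"
    by (intro measurable_free_energy) measurable
  hence "integral\<^sup>L gauss ?F = (\<integral>\<omega>. ?F (?X \<omega>) \<partial>M)"
    using X integral_distr[of ?X M gauss ?F] by simp
  thus ?thesis
    unfolding psi_M_def
    by (simp add: free_energy_def log_sum_exp_def gauss_vector_matrix_endpoint gauss_vector_vector_endpoint add.assoc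
       mult.assoc)
qed

theorem theorem2:
  fixes M :: "'w measure"
    and G :: "'w \<Rightarrow> real^'n^'m" and u2 :: "'w \<Rightarrow> real^'m"
    and h :: "'w \<Rightarrow> real^'n" and u4 :: "'w \<Rightarrow> real"
    and l :: nat and x :: "nat \<Rightarrow> real^'n" and \<beta> s :: real
  assumes "prob_space M"
    and "indep_std_gaussians M G u2 h u4"
    and "l \<ge> 1" and "\<beta> > 0" and "s \<in> {-1, 1}"
  shows "antimono_on {0..1} (psi_M M G u2 h u4 l x \<beta> s)"
proof -
  \<comment> \<open>The entries that occur in the configuration at t = 1.\<close>
  let ?S = "range (\<lambda>(i, j). Ent_G i j) \<union> {Ent_u4} :: ('m, 'n) entry_index set"
  have "antimono_on {0..1} (\<lambda>t. \<integral>z. free_energy {1..l} \<beta> s 0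
      (\<lambda>i. sqrt t *\<^sub>R gauss_vector (matrix_endpoint_coeff (x i)) z
        + sqrt (1 - t) *\<^sub>R gauss_vector (vector_endpoint_coeff (x i) :: ('m, 'n) entry_index \<Rightarrow> _) z) \<partial>gauss)"
  proof (rule interpolation_antimono[where S = ?S])
    show "\<forall>i. \<forall>k\<in>- ?S. matrix_endpoint_coeff (x i) k = (0 :: (real^'m) \<times> real)"
      by (auto simp: matrix_endpoint_coeff_def image_iff split: entry_index.splits)
    show "\<forall>i. \<forall>k\<in>?S. vector_endpoint_coeff (x i) k = (0 :: (real^'m) \<times> real)"
      by (auto simp: vector_endpoint_coeff_def)
    show "x i \<bullet> x i = norm (x i) * norm (x i)" for i
      by (simp add: dot_square_norm power2_eq_square)
  qed (use assms in \<open>auto intro: covariance_kernels_matrix_endpoint covariance_kernels_vector_endpoint norm_cauchy_schwarz\<close>)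
  thus ?thesis
    using assms(4) unfolding monotone_on_def psi_M_eq_gauss_integral[OF assms(1,2)]
    by (auto intro!: divide_right_mono)
qed

end
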